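(* Let $n\geqslant 1$, $p>1$ and $q\geqslant 0$. Let $\xi$ be a (unit) Hopf vector field on the round unit sphere $\mathbb{S}^{2n+1}\subset\mathbb{C}^{n+1}$, and let $\sigma=\tfrac{1}{\sqrt{p-1}}\,\xi$. Then $\sigma:\mathbb{S}^{2n+1}\to(T\mathbb{S}^{2n+1},h_{p,q})$ is a harmonic map, where $h_{p,q}$ is the generalised Cheeger-Gromoll metric.
   Context: The standard Hopf vector field on $\mathbb{S}^{2n+1}\subset\mathbb{C}^{n+1}$ is $\xi(z)=iz$ (up to isometries of the sphere); it is a unit Killing field. For a Riemannian manifold $(M,g)$ with Levi-Civita connection $\nabla$, let $\pi:TM\to M$ be the projection and $K:TTM\to TM$ the connection map. For $e\in TM$ put $\omega(e)=(1+|e|^2)^{-1}$. The generalised Cheeger-Gromoll metric $h_{p,q}$ on $TM$ is, for $A,B\in T_eTM$, $$h_{p,q}(A,B)=g(d\pi(A),d\pi(B))+\omega^p(e)\big[g(KA,KB)+q\,g(KA,e)g(KB,e)\big].$$ A smooth map $\sigma$ between Riemannian manifolds is harmonic if its tension field $\operatorname{trace}\nabla d\sigma$ vanishes. *)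

theory Defs
  imports "HOL-Analysis.Analysis"
begin

text \<open>
  Manifolds are embedded submanifolds of a Euclidean space \<open>'a\<close>; this covers the sphere and its
  tangent bundle, the latter inside \<open>'a \<times> 'a\<close>.  The coordinate space of the charts is a Euclidean
  space \<open>'e\<close>, whose dimension is the dimension of the manifold; it is passed as \<open>TYPE('e)\<close> where it
  cannot be inferred.  Tangent vectors of \<open>M\<close> are vectors of \<open>'a\<close>, and a Riemannian metric
  is a function \<open>g x v w\<close> that is only relevant for \<open>x \<in> M\<close> and \<open>v\<close>, \<open>w\<close> tangent at \<open>x\<close>.
  The metric may be any Riemannian metric; it need not be the one induced by \<open>'a\<close>.
\<close>

type_synonym 'a metric_field = "'a \<Rightarrow> 'a \<Rightarrow> 'a \<Rightarrow> real"

abbreviation dderiv :: "('a::real_normed_vector \<Rightarrow> 'b::real_normed_vector) \<Rightarrow> 'a \<Rightarrow> 'a \<Rightarrow> 'b"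
  where "dderiv f u \<equiv> frechet_derivative f (at u)"


section \<open>Smooth maps and submanifolds\<close>

primrec times_differentiable_on ::
    "nat \<Rightarrow> 'a set \<Rightarrow> ('a::real_normed_vector \<Rightarrow> 'b::real_normed_vector) \<Rightarrow> bool"
  where
    "times_differentiable_on 0 S f \<longleftrightarrow> continuous_on S f"
  | "times_differentiable_on (Suc k) S f \<longleftrightarrow>
       (\<forall>x\<in>S. f differentiable at x) \<and>
       (\<forall>v. times_differentiable_on k S (\<lambda>x. dderiv f x v))"

text \<open>Class \<open>C\<^sup>\<infinity>\<close>; only meant for open \<open>S\<close>.\<close>

definition smooth_on :: "'a set \<Rightarrow> ('a::real_normed_vector \<Rightarrow> 'b::real_normed_vector) \<Rightarrow> bool"
  where "smooth_on S f \<longleftrightarrow> (\<forall>k. times_differentiable_on k S f)"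

definition local_parametrization ::
    "'e::euclidean_space set \<Rightarrow> ('e \<Rightarrow> 'a::euclidean_space) \<Rightarrow> 'a set \<Rightarrow> bool"
  where
    "local_parametrization U \<phi> M \<longleftrightarrow>
       open U \<and> smooth_on U \<phi> \<and>
       openin (top_of_set M) (\<phi> ` U) \<and>
       (\<exists>\<phi>'. homeomorphism U (\<phi> ` U) \<phi> \<phi>') \<and>
       (\<forall>u\<in>U. inj (dderiv \<phi> u))"

definition submanifold :: "'e::euclidean_space itself \<Rightarrow> 'a::euclidean_space set \<Rightarrow> bool"
  where
    "submanifold _ M \<longleftrightarrow>
       (\<forall>x\<in>M. \<exists>(U::'e set) \<phi>. local_parametrization U \<phi> M \<and> x \<in> \<phi> ` U)"

definition tangent_space :: "'a::euclidean_space set \<Rightarrow> 'a \<Rightarrow> 'a set"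
  where
    "tangent_space M x =
       {v. \<exists>\<epsilon>>0. \<exists>\<gamma>. smooth_on {-\<epsilon><..<\<epsilon>} \<gamma> \<and> \<gamma> ` {-\<epsilon><..<\<epsilon>} \<subseteq> M \<and>
            \<gamma> 0 = x \<and> (\<gamma> has_vector_derivative v) (at (0::real))}"

definition tangent_bundle :: "'a::euclidean_space set \<Rightarrow> ('a \<times> 'a) set"
  where "tangent_bundle M = {(x, v). x \<in> M \<and> v \<in> tangent_space M x}"

definition tangent_map ::
    "('e::real_normed_vector \<Rightarrow> 'a::real_normed_vector) \<Rightarrow> 'e \<times> 'e \<Rightarrow> 'a \<times> 'a"
  where "tangent_map \<phi> = (\<lambda>(u, a). (\<phi> u, dderiv \<phi> u a))"

text \<open>As usual for embedded submanifolds, smoothness of a map into \<open>N \<subseteq> 'b\<close> is smoothness as a map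
  into \<open>'b\<close>.\<close>

definition smooth_map ::
    "'e::euclidean_space itself \<Rightarrow> 'a::euclidean_space set \<Rightarrow> 'b::euclidean_space set \<Rightarrow>
     ('a \<Rightarrow> 'b) \<Rightarrow> bool"
  where
    "smooth_map _ M N f \<longleftrightarrow>
       f ` M \<subseteq> N \<and>
       (\<forall>(U::'e set) \<phi>. local_parametrization U \<phi> M \<longrightarrow> smooth_on U (f \<circ> \<phi>))"


section \<open>Riemannian metrics, Levi-Civita connection and tension field\<close>

text \<open>The metric in a chart: \<open>pullback_metric g \<phi> u a b\<close> for \<open>a\<close>, \<open>b\<close> running over a basis are the
  coefficients \<open>g\<^sub>i\<^sub>j(u)\<close>.\<close>

definition pullback_metric ::
    "'a::real_normed_vector metric_field \<Rightarrow> ('e::real_normed_vector \<Rightarrow> 'a) \<Rightarrow> 'e metric_field"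
  where "pullback_metric g \<phi> u a b = g (\<phi> u) (dderiv \<phi> u a) (dderiv \<phi> u b)"

definition riemannian_manifold ::
    "'e::euclidean_space itself \<Rightarrow> 'a::euclidean_space set \<Rightarrow> 'a metric_field \<Rightarrow> bool"
  where
    "riemannian_manifold E M g \<longleftrightarrow>
       submanifold E M \<and>
       (\<forall>(U::'e set) \<phi>. local_parametrization U \<phi> M \<longrightarrow>
          (\<forall>u\<in>U. bilinear (pullback_metric g \<phi> u) \<and>
                 (\<forall>a b. pullback_metric g \<phi> u a b = pullback_metric g \<phi> u b a) \<and>
                 (\<forall>a. a \<noteq> 0 \<longrightarrow> pullback_metric g \<phi> u a a > 0)) \<and>
          (\<forall>a b. smooth_on U (\<lambda>u. pullback_metric g \<phi> u a b)))"

text \<open>\<open>christoffel G u a b\<close> is \<open>\<nabla>\<^sub>a b\<close> at \<open>u\<close> for the Levi-Civita connection of \<open>G\<close> and the constant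
  vector fields \<open>a\<close>, \<open>b\<close>, given by the Koszul formula (constant fields commute).  On basis vectors
  these are the vectors \<open>\<Sum>\<^sub>k \<Gamma>\<^sup>k\<^sub>i\<^sub>j e\<^sub>k\<close>.\<close>

definition christoffel :: "'e::euclidean_space metric_field \<Rightarrow> 'e \<Rightarrow> 'e \<Rightarrow> 'e \<Rightarrow> 'e"
  where
    "christoffel G u a b =
       (THE v. \<forall>c. 2 * G u v c =
          dderiv (\<lambda>u. G u b c) u a + dderiv (\<lambda>u. G u a c) u b - dderiv (\<lambda>u. G u a b) u c)"

text \<open>The second fundamental form \<open>(\<nabla>df)(a, b)\<close> of a map \<open>f\<close> between open subsets of Euclidean spaces
  with metrics \<open>G\<close>, \<open>H\<close>:
  \<open>\<partial>\<^sub>i\<partial>\<^sub>j f\<^sup>\<gamma> + \<Gamma>\<^sup>H\<^sup>\<gamma>\<^sub>\<alpha>\<^sub>\<beta> \<partial>\<^sub>i f\<^sup>\<alpha> \<partial>\<^sub>j f\<^sup>\<beta> - \<Gamma>\<^sup>G\<^sup>k\<^sub>i\<^sub>j \<partial>\<^sub>k f\<^sup>\<gamma>\<close>.\<close>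

definition second_fundamental_form ::
    "'e::euclidean_space metric_field \<Rightarrow> 'f::euclidean_space metric_field \<Rightarrow> ('e \<Rightarrow> 'f) \<Rightarrow>
     'e \<Rightarrow> 'e \<Rightarrow> 'e \<Rightarrow> 'f"
  where
    "second_fundamental_form G H f u a b =
       dderiv (\<lambda>u. dderiv f u b) u a +
       christoffel H (f u) (dderiv f u a) (dderiv f u b) -
       dderiv f u (christoffel G u a b)"

text \<open>The trace \<open>\<Sum>\<^sub>i\<^sub>j g\<^sup>i\<^sup>j B(e\<^sub>i, e\<^sub>j)\<close>: the vector \<open>\<Sum>\<^sub>j g\<^sup>i\<^sup>j e\<^sub>j\<close> is the one dual under \<open>g\<close> to the \<open>i\<close>-th
  coordinate functional.\<close>

definition metric_trace ::
    "('e::euclidean_space \<Rightarrow> 'e \<Rightarrow> real) \<Rightarrow> ('e \<Rightarrow> 'e \<Rightarrow> 'f::real_vector) \<Rightarrow> 'f"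
  where
    "metric_trace g B = (\<Sum>i\<in>Basis. B i (THE v. \<forall>w. g v w = i \<bullet> w))"

definition tension_field ::
    "'e::euclidean_space metric_field \<Rightarrow> 'f::euclidean_space metric_field \<Rightarrow> ('e \<Rightarrow> 'f) \<Rightarrow> 'e \<Rightarrow> 'f"
  where "tension_field G H f u = metric_trace (G u) (second_fundamental_form G H f u)"

text \<open>The tension field is tensorial; it vanishes iff its expression in local charts does.\<close>

definition harmonic_map ::
    "'e::euclidean_space itself \<Rightarrow> 'f::euclidean_space itself \<Rightarrow>
     'a::euclidean_space set \<Rightarrow> 'a metric_field \<Rightarrow>
     'b::euclidean_space set \<Rightarrow> 'b metric_field \<Rightarrow> ('a \<Rightarrow> 'b) \<Rightarrow> bool"
  where
    "harmonic_map E F M g N h f \<longleftrightarrow>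
       riemannian_manifold E M g \<and> riemannian_manifold F N h \<and> smooth_map E M N f \<and>
       (\<forall>(U::'e set) \<phi> (V::'f set) \<psi>.
          local_parametrization U \<phi> M \<longrightarrow> local_parametrization V \<psi> N \<longrightarrow>
          (\<forall>u\<in>U. f (\<phi> u) \<in> \<psi> ` V \<longrightarrow>
             tension_field (pullback_metric g \<phi>) (pullback_metric h \<psi>)
               (inv_into V \<psi> \<circ> f \<circ> \<phi>) u = 0))"


section \<open>The generalised Cheeger-Gromoll metric\<close>

text \<open>The connection map \<open>K : TTM \<rightarrow> TM\<close> of the Levi-Civita connection of \<open>(M, g)\<close>.  In the chart
  \<open>tangent_map \<phi>\<close> of \<open>TM\<close> it sends the tangent vector \<open>(a, b)\<close> at \<open>(u, \<epsilon>)\<close> to \<open>b + \<Gamma>(a, \<epsilon>)\<close>;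
  equivalently, \<open>K (dX(v)) = \<nabla>\<^sub>v X\<close> for vector fields \<open>X\<close>.\<close>

definition connection_map ::
    "'e::euclidean_space itself \<Rightarrow> 'a::euclidean_space set \<Rightarrow> 'a metric_field \<Rightarrow>
     'a \<times> 'a \<Rightarrow> 'a \<times> 'a \<Rightarrow> 'a"
  where
    "connection_map _ M g e A =
       (THE k. \<exists>(U::'e set) \<phi> u \<epsilon> a b.
          local_parametrization U \<phi> M \<and> u \<in> U \<and>
          e = tangent_map \<phi> (u, \<epsilon>) \<and>
          A = dderiv (tangent_map \<phi>) (u, \<epsilon>) (a, b) \<and>
          k = dderiv \<phi> u (b + christoffel (pullback_metric g \<phi>) u a \<epsilon>))"

text \<open>An element \<open>e\<close> of \<open>TM\<close> is the pair of its base point and its vector part.  As the projection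
  \<open>\<pi>\<close> is \<open>fst\<close>, so is \<open>d\<pi>\<close>.\<close>

definition cheeger_gromoll ::
    "'e::euclidean_space itself \<Rightarrow> 'a::euclidean_space set \<Rightarrow> 'a metric_field \<Rightarrow> real \<Rightarrow> real \<Rightarrow>
     ('a \<times> 'a) metric_field"
  where
    "cheeger_gromoll E M g p q e A B =
       (let x = fst e; v = snd e;
            \<omega> = 1 / (1 + g x v v);
            KA = connection_map E M g e A;
            KB = connection_map E M g e B
        in g x (fst A) (fst B) + \<omega> powr p * (g x KA KB + q * g x KA v * g x KB v))"


section \<open>The round sphere and Hopf vector fields\<close>

definition round_metric :: "'a::euclidean_space metric_field"
  where "round_metric x v w = v \<bullet> w"

text \<open>The isometries of the unit sphere are the restrictions of the real orthogonal transformations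
  \<open>F\<close> of the ambient space, and \<open>dF = F\<close>; so \<open>\<xi>\<close> is the push-forward by \<open>F\<close> of \<open>z \<mapsto> \<i>z\<close>.\<close>

definition hopf_vector_field :: "(complex^'n \<Rightarrow> complex^'n) \<Rightarrow> bool"
  where
    "hopf_vector_field \<xi> \<longleftrightarrow>
       (\<exists>F :: complex^'n \<Rightarrow> complex^'n. orthogonal_transformation F \<and>
          (\<forall>z\<in>sphere 0 1. \<xi> (F z) = F (\<i> *s z)))"

end

(*
Everything is computed in the ambient Euclidean space.  If a metric on N is the restriction of a
field H of bilinear forms on the ambient space, and f : M -> N is given as an ambient-valued map F,
the Koszul formula shows that the second fundamental form B of f satisfies, for C tangent to N,
  2 H(B(a,b), C) = 2 H(D^2 F(a,b) - dF(Gamma(a,b)), C)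
                   + DH(dF a)(dF b, C) + DH(dF b)(dF a, C) - DH(C)(dF a, dF b),
whatever chart of N is used.  At (x, v) the connection map of the sphere is
A |-> snd A + (fst A . v) x, so h_{p,q} is the restriction of an explicit such H that depends on v
only.  For F x = (x, c J x) with J skew and orthogonal, D^2 F - dF Gamma is -(a . b) F x, and tracing
over an orthonormal frame leaves a multiple of (v . snd C) that vanishes because c^2 (p - 1) = 1.
*)
theory Submission
  imports Defs
begin

section \<open>Calculus of smooth maps\<close>

text \<open>Harmonicity is tested in every chart \<open>\<psi>\<close> of the tangent bundle through
  \<open>inv_into V \<psi> \<circ> \<sigma> \<circ> \<phi>\<close>, and a chart inverse is only
  given as continuous. The local expression must therefore be shown twice differentiable before its
  second fundamental form has any meaning; a linear left inverse of the injective derivative of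
  \<open>\<psi>\<close> achieves this without an inverse function theorem. Pairing with vectors
  \<open>dderiv \<psi> (f u) c\<close> loses nothing, because the form is positive on them.
  Christoffel vectors and dual basis vectors are unique descriptions, resolved by representing
  linear functionals through a positive form; the connection map is resolved by a formula free of
  charts. Origin of the constant: for arbitrary \<open>c\<close> the traced expression is a nonzero
  multiple of \<open>n * (1 + c\<^sup>2 - p * c\<^sup>2) * (v \<bullet> snd C)\<close>. The
  parameter \<open>q\<close> cancels in this trace, while \<open>q \<ge> 0\<close> secures
  positivity of the metric.\<close>

lemma dderiv_eqI: "(f has_derivative f') (at x) \<Longrightarrow> dderiv f x = f'"
  by (metis frechet_derivative_at)

lemma differentiable_has_dderiv: "f differentiable (at x) \<Longrightarrow> (f has_derivative dderiv f x) (at x)"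
  by (simp add: frechet_derivative_works)

lemma dderiv_cong_open:
  assumes "open S" "x \<in> S" "\<And>y. y \<in> S \<Longrightarrow> f y = g y"
  shows "dderiv f x = dderiv g x"
proof -
  have "(f has_derivative D) (at x) \<longleftrightarrow> (g has_derivative D) (at x)" for D
    using assms has_derivative_transform_within_open[of f D x UNIV S g]
      has_derivative_transform_within_open[of g D x UNIV S f] by auto
  then show ?thesis
    by (simp add: frechet_derivative_def)
qed

lemma differentiable_cong_open:
  assumes "open S" "x \<in> S" "\<And>y. y \<in> S \<Longrightarrow> f y = g y" "f differentiable (at x)"
  shows "g differentiable (at x)"
  using assms has_derivative_transform_within_open[of f _ x UNIV S g]
  unfolding differentiable_def by blast

section \<open>Closure properties of the finite differentiability classes\<close>

lemma times_differentiable_on_cong: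
  assumes "open S" "\<And>y. y \<in> S \<Longrightarrow> f y = g y" "times_differentiable_on k S f"
  shows "times_differentiable_on k S g"
  using assms(2,3)
proof (induction k arbitrary: f g)
  case 0
  then show ?case
    using continuous_on_cong[OF refl, of S f g] by simp
next
  case (Suc k)
  have "times_differentiable_on k S (\<lambda>x. dderiv g x v)" for v
  proof (rule Suc.IH)
    show "dderiv f y v = dderiv g y v" if "y \<in> S" for y
      using dderiv_cong_open[OF \<open>open S\<close> that Suc.prems(1)] by simp
    show "times_differentiable_on k S (\<lambda>x. dderiv f x v)"
      using Suc.prems(2) by simp
  qed
  moreover have "g differentiable (at x)" if "x \<in> S" for x
    using differentiable_cong_open[OF \<open>open S\<close> that Suc.prems(1)] Suc.prems(2) that by simp
  ultimately show ?case
    by simp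
qed

text \<open>In the product and chain rules an undifferentiated factor stands beside a differentiated
  one, so a function of level \<open>Suc k\<close> must also count as one of level
  \<open>k\<close>.\<close>

lemma times_differentiable_on_Suc_imp:
  "times_differentiable_on (Suc k) S f \<Longrightarrow> times_differentiable_on k S f"
proof (induction k arbitrary: f)
  case 0
  then show ?case
    by (auto intro!: continuous_at_imp_continuous_on differentiable_imp_continuous_within)
next
  case (Suc k)
  then have "times_differentiable_on k S (\<lambda>x. dderiv f x v)" for v
    by (metis times_differentiable_on.simps(2))
  then show ?case
    using Suc.prems by simp
qed

lemma times_differentiable_on_subset:
  "times_differentiable_on k S f \<Longrightarrow> T \<subseteq> S \<Longrightarrow> times_differentiable_on k T f"
  by (induction k arbitrary: f) (auto intro: continuous_on_subset)

lemma times_differentiable_on_const: "times_differentiable_on k S (\<lambda>x. c)"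
  by (induction k arbitrary: c) auto

lemma times_differentiable_on_bounded_linear:
  assumes "bounded_linear L"
  shows "times_differentiable_on k S L"
proof (cases k)
  case 0
  then show ?thesis
    by (simp add: linear_continuous_on assms)
next
  case (Suc m)
  have "dderiv L x = L" for x
    by (intro dderiv_eqI bounded_linear_imp_has_derivative assms)
  then show ?thesis
    using Suc bounded_linear_imp_differentiable[OF assms]
    by (simp add: times_differentiable_on_const)
qed

lemma times_differentiable_on_bounded_linear_compose:
  assumes "bounded_linear L" "open S"
  shows "times_differentiable_on k S f \<Longrightarrow> times_differentiable_on k S (\<lambda>x. L (f x))"
proof (induction k arbitrary: f)
  case 0
  then show ?case
    by (simp add: bounded_linear.continuous_on assms)
next
  case (Suc k)
  have d: "((\<lambda>x. L (f x)) has_derivative (\<lambda>v. L (dderiv f x v))) (at x)" if "x \<in> S" for x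
    by (rule bounded_linear.has_derivative[OF assms(1) differentiable_has_dderiv])
      (use Suc.prems that in simp)
  have "times_differentiable_on k S (\<lambda>x. dderiv (\<lambda>x. L (f x)) x v)" for v
  proof (rule times_differentiable_on_cong[OF \<open>open S\<close>])
    show "times_differentiable_on k S (\<lambda>x. L (dderiv f x v))"
      using Suc by simp
  qed (simp add: dderiv_eqI[OF d])
  then show ?case
    using d[THEN differentiableI] by simp
qed

lemma times_differentiable_on_add:
  assumes "open S"
  shows "times_differentiable_on k S f \<Longrightarrow> times_differentiable_on k S g \<Longrightarrow>
    times_differentiable_on k S (\<lambda>x. f x + g x)"
proof (induction k arbitrary: f g)
  case 0
  then show ?case
    by (simp add: continuous_on_add)
next
  case (Suc k)
  have d: "((\<lambda>x. f x + g x) has_derivative (\<lambda>v. dderiv f x v + dderiv g x v)) (at x)"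
    if "x \<in> S" for x
    using Suc.prems that
    by (auto intro!: has_derivative_add differentiable_has_dderiv)
  have "times_differentiable_on k S (\<lambda>x. dderiv (\<lambda>x. f x + g x) x v)" for v
  proof (rule times_differentiable_on_cong[OF \<open>open S\<close>])
    show "times_differentiable_on k S (\<lambda>x. dderiv f x v + dderiv g x v)"
      using Suc by simp
  qed (simp add: dderiv_eqI[OF d])
  then show ?case
    using d[THEN differentiableI] by simp
qed

lemma times_differentiable_on_bounded_bilinear:
  assumes "bounded_bilinear h" "open S"
  shows "times_differentiable_on k S f \<Longrightarrow> times_differentiable_on k S g \<Longrightarrow>
    times_differentiable_on k S (\<lambda>x. h (f x) (g x))"
proof (induction k arbitrary: f g)
  case 0
  then show ?case
    by (simp add: bounded_bilinear.continuous_on[OF assms(1)])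
next
  case (Suc k)
  have d: "((\<lambda>x. h (f x) (g x)) has_derivative (\<lambda>v. h (f x) (dderiv g x v) + h (dderiv f x v) (g x))) (at x)"
    if "x \<in> S" for x
    using Suc.prems that
    by (auto intro!: bounded_bilinear.FDERIV[OF assms(1)] differentiable_has_dderiv)
  have "times_differentiable_on k S (\<lambda>x. dderiv (\<lambda>x. h (f x) (g x)) x v)" for v
  proof (rule times_differentiable_on_cong[OF \<open>open S\<close>])
    show "times_differentiable_on k S (\<lambda>x. h (f x) (dderiv g x v) + h (dderiv f x v) (g x))"
      using Suc.prems Suc.prems[THEN times_differentiable_on_Suc_imp]
      by (intro times_differentiable_on_add \<open>open S\<close> Suc.IH) auto
  qed (simp add: dderiv_eqI[OF d])
  then show ?case
    using d[THEN differentiableI] by simp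
qed

lemma times_differentiable_on_sum:
  assumes "open S" "\<And>i. i \<in> I \<Longrightarrow> times_differentiable_on k S (f i)"
  shows "times_differentiable_on k S (\<lambda>x. \<Sum>i\<in>I. f i x)"
  using assms(2)
  by (induction I rule: infinite_finite_induct)
    (auto intro: times_differentiable_on_const times_differentiable_on_add assms(1))

text \<open>The differentiability classes differentiate in fixed directions, whereas the chain rule
  and \<open>tangent_map\<close> evaluate a derivative in a direction that moves with the point.
  Expanding that direction in the basis leaves fixed directions with smooth coefficients.\<close>

lemma linear_euclidean_expand:
  fixes x :: "'a::euclidean_space"
  assumes "linear L"
  shows "L x = (\<Sum>i\<in>Basis. (x \<bullet> i) *\<^sub>R L i)"
proof -
  have "L x = L (\<Sum>i\<in>Basis. (x \<bullet> i) *\<^sub>R i)"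
    by (simp add: euclidean_representation)
  then show ?thesis
    by (simp add: linear_sum[OF assms] linear_cmul[OF assms])
qed

lemma times_differentiable_on_compose:
  fixes f :: "'a::real_normed_vector \<Rightarrow> 'b::euclidean_space"
    and g :: "'b \<Rightarrow> 'c::real_normed_vector"
  assumes "open S" "open T" "f ` S \<subseteq> T"
  shows "times_differentiable_on k T g \<Longrightarrow> times_differentiable_on k S f \<Longrightarrow>
    times_differentiable_on k S (\<lambda>x. g (f x))"
  using assms(3)
proof (induction k arbitrary: f g)
  case 0
  then show ?case
    using continuous_on_compose2[of T g S f] by simp
next
  case (Suc k)
  have d: "((\<lambda>x. g (f x)) has_derivative (\<lambda>v. dderiv g (f x) (dderiv f x v))) (at x)"
    and e: "dderiv g (f x) (dderiv f x v) =
      (\<Sum>i\<in>Basis. (dderiv f x v \<bullet> i) *\<^sub>R dderiv g (f x) i)" if "x \<in> S" for x v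
  proof -
    have g: "g differentiable (at (f x))"
      using that Suc.prems by auto
    have f: "(f has_derivative dderiv f x) (at x)"
      by (rule differentiable_has_dderiv) (use that Suc.prems in auto)
    show "((\<lambda>x. g (f x)) has_derivative (\<lambda>v. dderiv g (f x) (dderiv f x v))) (at x)"
      using has_derivative_compose[OF f differentiable_has_dderiv[OF g]] .
    show "dderiv g (f x) (dderiv f x v) =
      (\<Sum>i\<in>Basis. (dderiv f x v \<bullet> i) *\<^sub>R dderiv g (f x) i)"
      by (rule linear_euclidean_expand) (rule linear_frechet_derivative[OF g])
  qed
  have "times_differentiable_on k S (\<lambda>x. dderiv (\<lambda>x. g (f x)) x v)" for v
  proof (rule times_differentiable_on_cong[OF \<open>open S\<close>])
    show "times_differentiable_on k S
        (\<lambda>x. \<Sum>i\<in>Basis. (dderiv f x v \<bullet> i) *\<^sub>R dderiv g (f x) i)"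
    proof (rule times_differentiable_on_sum[OF \<open>open S\<close>],
        rule times_differentiable_on_bounded_bilinear[OF bounded_bilinear_scaleR \<open>open S\<close>])
      fix i :: 'b
      show "times_differentiable_on k S (\<lambda>x. dderiv f x v \<bullet> i)"
        using Suc.prems
        by (intro times_differentiable_on_bounded_linear_compose[OF bounded_linear_inner_left \<open>open S\<close>])
           simp
      show "times_differentiable_on k S (\<lambda>x. dderiv g (f x) i)"
        using Suc.prems times_differentiable_on_Suc_imp[OF Suc.prems(2)]
        by (intro Suc.IH) auto
    qed
  qed (simp add: dderiv_eqI[OF d] e)
  then show ?case
    using d[THEN differentiableI] by simp
qed

section \<open>Smooth maps, with closure properties inherited from the finite classes\<close>

lemma smooth_on_cong:
  "smooth_on S f \<Longrightarrow> open S \<Longrightarrow> (\<And>y. y \<in> S \<Longrightarrow> f y = g y) \<Longrightarrow> smooth_on S g"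
  unfolding smooth_on_def using times_differentiable_on_cong by blast

lemma smooth_on_subset: "smooth_on S f \<Longrightarrow> T \<subseteq> S \<Longrightarrow> smooth_on T f"
  unfolding smooth_on_def using times_differentiable_on_subset by blast

lemma smooth_on_const: "smooth_on S (\<lambda>x. c)"
  by (simp add: smooth_on_def times_differentiable_on_const)

lemma smooth_on_bounded_linear: "bounded_linear L \<Longrightarrow> smooth_on S L"
  by (simp add: smooth_on_def times_differentiable_on_bounded_linear)

lemma smooth_on_bounded_linear_compose:
  "bounded_linear L \<Longrightarrow> open S \<Longrightarrow> smooth_on S f \<Longrightarrow> smooth_on S (\<lambda>x. L (f x))"
  by (simp add: smooth_on_def times_differentiable_on_bounded_linear_compose)

lemma smooth_on_add:
  "open S \<Longrightarrow> smooth_on S f \<Longrightarrow> smooth_on S g \<Longrightarrow> smooth_on S (\<lambda>x. f x + g x)"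
  by (simp add: smooth_on_def times_differentiable_on_add)

lemma smooth_on_bounded_bilinear:
  "bounded_bilinear h \<Longrightarrow> open S \<Longrightarrow> smooth_on S f \<Longrightarrow> smooth_on S g \<Longrightarrow>
    smooth_on S (\<lambda>x. h (f x) (g x))"
  by (simp add: smooth_on_def times_differentiable_on_bounded_bilinear)

lemmas smooth_on_inner = smooth_on_bounded_bilinear[OF bounded_bilinear_inner]
lemmas smooth_on_scaleR = smooth_on_bounded_bilinear[OF bounded_bilinear_scaleR]
lemmas smooth_on_mult = smooth_on_bounded_bilinear[OF bounded_bilinear_mult]
lemmas smooth_on_fst = smooth_on_bounded_linear_compose[OF bounded_linear_fst]
lemmas smooth_on_snd = smooth_on_bounded_linear_compose[OF bounded_linear_snd]

lemma smooth_on_minus: "open S \<Longrightarrow> smooth_on S f \<Longrightarrow> smooth_on S (\<lambda>x. - f x)"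
  by (rule smooth_on_bounded_linear_compose[OF bounded_linear_minus[OF bounded_linear_ident]])

lemma smooth_on_diff:
  "open S \<Longrightarrow> smooth_on S f \<Longrightarrow> smooth_on S g \<Longrightarrow> smooth_on S (\<lambda>x. f x - g x)"
  using smooth_on_add[OF _ _ smooth_on_minus] by simp

lemma smooth_on_sum:
  "open S \<Longrightarrow> (\<And>i. i \<in> I \<Longrightarrow> smooth_on S (f i)) \<Longrightarrow> smooth_on S (\<lambda>x. \<Sum>i\<in>I. f i x)"
  by (simp add: smooth_on_def times_differentiable_on_sum)

lemma smooth_on_Pair:
  assumes "open S" "smooth_on S f" "smooth_on S g"
  shows "smooth_on S (\<lambda>x. (f x, g x))"
proof -
  have "bounded_linear (\<lambda>y::'b. (y, 0::'c))" "bounded_linear (\<lambda>y::'c. (0::'b, y))"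
    by (intro bounded_linear_Pair bounded_linear_ident bounded_linear_zero)+
  note L = this[THEN smooth_on_bounded_linear_compose, OF assms(1)]
  have "smooth_on S (\<lambda>x. (f x, 0::'c) + (0::'b, g x))"
    by (rule smooth_on_add[OF assms(1) L(1)[OF assms(2)] L(2)[OF assms(3)]])
  then show ?thesis
    by simp
qed

lemma smooth_on_compose:
  fixes f :: "'a::real_normed_vector \<Rightarrow> 'b::euclidean_space"
  assumes "smooth_on T g" "open T" "smooth_on S f" "open S" "f ` S \<subseteq> T"
  shows "smooth_on S (\<lambda>x. g (f x))"
  using assms times_differentiable_on_compose[of S T f] unfolding smooth_on_def by blast

lemma smooth_on_dderiv:
  assumes "smooth_on S f"
  shows "smooth_on S (\<lambda>x. dderiv f x v)"
  unfolding smooth_on_def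
proof
  show "times_differentiable_on k S (\<lambda>x. dderiv f x v)" for k
    using assms[unfolded smooth_on_def, THEN spec, of "Suc k"] by simp
qed

lemma smooth_on_imp_differentiable: "smooth_on S f \<Longrightarrow> x \<in> S \<Longrightarrow> f differentiable (at x)"
  unfolding smooth_on_def by (drule spec[of _ "Suc 0"]) simp

lemma smooth_on_has_derivative:
  "smooth_on S f \<Longrightarrow> x \<in> S \<Longrightarrow> (f has_derivative dderiv f x) (at x)"
  by (simp add: smooth_on_imp_differentiable differentiable_has_dderiv)

lemma smooth_on_imp_continuous_on: "smooth_on S f \<Longrightarrow> continuous_on S f"
  unfolding smooth_on_def by (drule spec[of _ 0]) simp

lemma smooth_on_linear_dderiv: "smooth_on S f \<Longrightarrow> x \<in> S \<Longrightarrow> linear (dderiv f x)"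
  by (simp add: smooth_on_imp_differentiable linear_frechet_derivative)

text \<open>The exponent stays arbitrary in the induction because each derivative lowers it by one.
  Reciprocals and square roots in the sphere charts, and the weight of the metric, are all written
  as powers, so this fact covers them together.\<close>

lemma smooth_on_powr: "smooth_on {0<..} (\<lambda>x::real. x powr s)"
proof -
  have "times_differentiable_on k {0<..} (\<lambda>x::real. x powr s)" for k
  proof (induction k arbitrary: s)
    case 0
    show ?case
      by (auto intro!: continuous_on_powr continuous_on_id continuous_on_const)
  next
    case (Suc k)
    have d: "((\<lambda>x::real. x powr s) has_derivative (\<lambda>v. (s * v) * x powr (s - 1))) (at x)"
      if "x \<in> {0<..}" for x :: real
      using that by (auto intro!: derivative_eq_intros simp: powr_diff field_simps)
    have "times_differentiable_on k {0<..} (\<lambda>x. dderiv (\<lambda>x::real. x powr s) x v)" for v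
    proof (rule times_differentiable_on_cong)
      show "times_differentiable_on k {0<..} (\<lambda>x::real. (s * v) * x powr (s - 1))"
        by (intro times_differentiable_on_bounded_bilinear[OF bounded_bilinear_mult]
            times_differentiable_on_const Suc) auto
    qed (simp_all add: dderiv_eqI[OF d])
    then show ?case
      using d[THEN differentiableI] by simp
  qed
  then show ?thesis
    by (simp add: smooth_on_def)
qed

lemma smooth_on_powr_compose:
  fixes f :: "'a::real_normed_vector \<Rightarrow> real"
  assumes "smooth_on S f" "open S" "\<And>x. x \<in> S \<Longrightarrow> 0 < f x"
  shows "smooth_on S (\<lambda>x. f x powr s)"
  by (rule smooth_on_compose[OF smooth_on_powr _ assms(1,2)]) (use assms(3) in auto)

lemma smooth_on_tangent_map:
  fixes f :: "'a::euclidean_space \<Rightarrow> 'b::real_normed_vector"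
  assumes "open S" "smooth_on S f"
  shows "smooth_on (S \<times> UNIV) (tangent_map f)"
proof (rule smooth_on_cong)
  have o: "open (S \<times> (UNIV::'a set))"
    using assms by (simp add: open_Times)
  have fst: "smooth_on (S \<times> (UNIV::'a set)) fst" and snd: "smooth_on (S \<times> (UNIV::'a set)) snd"
    by (simp_all add: smooth_on_bounded_linear bounded_linear_fst bounded_linear_snd)
  show "smooth_on (S \<times> (UNIV::'a set)) (\<lambda>z. (f (fst z), \<Sum>i\<in>Basis. (snd z \<bullet> i) *\<^sub>R dderiv f (fst z) i))"
  proof (intro smooth_on_Pair[OF o] smooth_on_sum[OF o] smooth_on_scaleR[OF o])
    show "smooth_on (S \<times> (UNIV::'a set)) (\<lambda>z. f (fst z))"
      by (rule smooth_on_compose[OF assms(2,1) fst o]) auto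
    show "smooth_on (S \<times> (UNIV::'a set)) (\<lambda>z. dderiv f (fst z) i)" for i
      by (rule smooth_on_compose[OF smooth_on_dderiv[OF assms(2)] assms(1) fst o]) auto
    show "smooth_on (S \<times> (UNIV::'a set)) (\<lambda>z. snd z \<bullet> i)" for i :: 'a
      by (rule smooth_on_inner[OF o snd smooth_on_const])
  qed
  show "open (S \<times> (UNIV::'a set))"
    by fact
  show "(f (fst z), \<Sum>i\<in>Basis. (snd z \<bullet> i) *\<^sub>R dderiv f (fst z) i) = tangent_map f z"
    if "z \<in> S \<times> UNIV" for z
    using that linear_euclidean_expand[OF smooth_on_linear_dderiv[OF assms(2)], of "fst z" "snd z"]
    by (auto simp: tangent_map_def)
qed

section \<open>Second derivatives and their symmetry\<close>

definition dderiv2 :: "('a::real_normed_vector \<Rightarrow> 'b::real_normed_vector) \<Rightarrow> 'a \<Rightarrow> 'a \<Rightarrow> 'a \<Rightarrow> 'b"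
  where "dderiv2 f x a b = dderiv (\<lambda>y. dderiv f y b) x a"

lemma smooth_on_has_derivative2:
  "smooth_on S f \<Longrightarrow> x \<in> S \<Longrightarrow> ((\<lambda>y. dderiv f y b) has_derivative (\<lambda>a. dderiv2 f x a b)) (at x)"
  unfolding dderiv2_def by (intro smooth_on_has_derivative smooth_on_dderiv)

text \<open>A linear map on a product is determined by its values on \<open>(a, 0)\<close> and
  \<open>(0, b)\<close>. Freezing the vector \<open>e\<close> gives the former; freezing the point
  \<open>x\<close>, where \<open>tangent_map f\<close> is linear in the vector, gives the
  latter.\<close>

lemma dderiv_tangent_map:
  fixes f :: "'a::euclidean_space \<Rightarrow> 'b::real_normed_vector"
  assumes "open S" "smooth_on S f" "x \<in> S"
  shows "dderiv (tangent_map f) (x, e) (a, b) = (dderiv f x a, dderiv2 f x a e + dderiv f x b)"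
proof -
  have lin: "linear (dderiv (tangent_map f) (x, e))"
    using smooth_on_linear_dderiv[OF smooth_on_tangent_map[OF assms(1,2)]] assms(3) by simp
  have D: "(tangent_map f has_derivative dderiv (tangent_map f) (x, e)) (at (x, e))"
    using smooth_on_has_derivative[OF smooth_on_tangent_map[OF assms(1,2)]] assms(3) by simp
  have f1: "(f has_derivative dderiv f x) (at x)"
    by (rule smooth_on_has_derivative[OF assms(2,3)])
  have f2: "((\<lambda>y. dderiv f y e) has_derivative (\<lambda>a. dderiv2 f x a e)) (at x)"
    by (rule smooth_on_has_derivative2[OF assms(2,3)])
  have f3: "(dderiv f x has_derivative dderiv f x) (at e)"
    by (rule linear_imp_has_derivative[OF smooth_on_linear_dderiv[OF assms(2,3)]])
  have "((\<lambda>y. tangent_map f (y, e)) has_derivative (\<lambda>a. dderiv (tangent_map f) (x, e) (a, 0))) (at x)"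
    by (rule has_derivative_compose[OF has_derivative_Pair[OF has_derivative_ident has_derivative_const] D])
  moreover have "((\<lambda>y. tangent_map f (y, e)) has_derivative (\<lambda>a. (dderiv f x a, dderiv2 f x a e))) (at x)"
    using has_derivative_Pair[OF f1 f2] by (simp add: tangent_map_def)
  ultimately have 1: "dderiv (tangent_map f) (x, e) (a, 0) = (dderiv f x a, dderiv2 f x a e)" for a
    by (rule fun_cong[OF has_derivative_unique])
  have "((\<lambda>y. tangent_map f (x, y)) has_derivative (\<lambda>a. dderiv (tangent_map f) (x, e) (0, a))) (at e)"
    by (rule has_derivative_compose[OF has_derivative_Pair[OF has_derivative_const has_derivative_ident] D])
  moreover have "((\<lambda>y. tangent_map f (x, y)) has_derivative (\<lambda>a. (0, dderiv f x a))) (at e)"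
    using has_derivative_Pair[OF has_derivative_const f3, of "f x"] by (simp add: tangent_map_def)
  ultimately have 2: "dderiv (tangent_map f) (x, e) (0, b) = (0, dderiv f x b)"
    by (rule fun_cong[OF has_derivative_unique])
  show ?thesis
    using linear_add[OF lin, of "(a, 0)" "(0, b)"] by (simp add: 1 2)
qed

text \<open>Both second derivatives are limits of the same second difference quotient, by the mean value
  theorem applied in the two possible orders.\<close>

lemma second_difference_mvt:
  fixes f :: "'a::real_normed_vector \<Rightarrow> real"
  assumes ball: "\<And>s t. 0 \<le> s \<Longrightarrow> s \<le> h \<Longrightarrow> 0 \<le> t \<Longrightarrow> t \<le> h \<Longrightarrow> x + s *\<^sub>R a + t *\<^sub>R b \<in> S"
    and f: "\<And>y. y \<in> S \<Longrightarrow> (f has_derivative f' y) (at y)"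
    and f': "\<And>y. y \<in> S \<Longrightarrow> ((\<lambda>y. f' y a) has_derivative f'' y) (at y)"
    and "0 < h"
  obtains s t where "0 \<le> s" "s \<le> h" "0 \<le> t" "t \<le> h"
    "f (x + h *\<^sub>R a + h *\<^sub>R b) - f (x + h *\<^sub>R a) - f (x + h *\<^sub>R b) + f x =
      h * h * f'' (x + s *\<^sub>R a + t *\<^sub>R b) b"
proof -
  have d1: "((\<lambda>s. f (x + s *\<^sub>R a + t *\<^sub>R b)) has_real_derivative f' (x + s *\<^sub>R a + t *\<^sub>R b) a) (at s)"
    if "0 \<le> s" "s \<le> h" "0 \<le> t" "t \<le> h" for s t
  proof -
    have D: "(f has_derivative f' (x + s *\<^sub>R a + t *\<^sub>R b)) (at (x + s *\<^sub>R a + t *\<^sub>R b))"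
      using that by (intro f ball)
    have "((\<lambda>s. x + s *\<^sub>R a + t *\<^sub>R b) has_derivative (\<lambda>r. r *\<^sub>R a)) (at s)"
      by (auto intro!: derivative_eq_intros)
    from has_derivative_compose[OF this D] show ?thesis
      using linear_cmul[OF has_derivative_linear[OF D]]
      by (simp add: has_field_derivative_def mult_commute_abs)
  qed
  have d2: "((\<lambda>t. f' (x + s *\<^sub>R a + t *\<^sub>R b) a) has_real_derivative f'' (x + s *\<^sub>R a + t *\<^sub>R b) b) (at t)"
    if "0 \<le> s" "s \<le> h" "0 \<le> t" "t \<le> h" for s t
  proof -
    have D: "((\<lambda>y. f' y a) has_derivative f'' (x + s *\<^sub>R a + t *\<^sub>R b)) (at (x + s *\<^sub>R a + t *\<^sub>R b))"
      using that by (intro f' ball)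
    have "((\<lambda>t. x + s *\<^sub>R a + t *\<^sub>R b) has_derivative (\<lambda>r. r *\<^sub>R b)) (at t)"
      by (auto intro!: derivative_eq_intros)
    from has_derivative_compose[OF this D] show ?thesis
      using linear_cmul[OF has_derivative_linear[OF D]]
      by (simp add: has_field_derivative_def mult_commute_abs)
  qed
  \<comment> \<open>Differencing in direction \<open>b\<close> turns the second difference into
    \<open>g h - g 0\<close>; a mean value step in \<open>s\<close> and another in \<open>t\<close>
    then produce the mixed derivative.\<close>
  define g where "g s = f (x + s *\<^sub>R a + h *\<^sub>R b) - f (x + s *\<^sub>R a + 0 *\<^sub>R b)" for s
  have "DERIV g s :> f' (x + s *\<^sub>R a + h *\<^sub>R b) a - f' (x + s *\<^sub>R a + 0 *\<^sub>R b) a"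
    if "0 \<le> s" "s \<le> h" for s
    unfolding g_def using that \<open>0 < h\<close> by (intro DERIV_diff d1) auto
  from MVT2[OF \<open>0 < h\<close> this] obtain s where s: "0 < s" "s < h"
    "g h - g 0 = (h - 0) * (f' (x + s *\<^sub>R a + h *\<^sub>R b) a - f' (x + s *\<^sub>R a + 0 *\<^sub>R b) a)"
    by blast
  have "DERIV (\<lambda>t. f' (x + s *\<^sub>R a + t *\<^sub>R b) a) t :> f'' (x + s *\<^sub>R a + t *\<^sub>R b) b"
    if "0 \<le> t" "t \<le> h" for t
    using that s by (intro d2) auto
  from MVT2[OF \<open>0 < h\<close> this] obtain t where t: "0 < t" "t < h"
    "f' (x + s *\<^sub>R a + h *\<^sub>R b) a - f' (x + s *\<^sub>R a + 0 *\<^sub>R b) a =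
      (h - 0) * f'' (x + s *\<^sub>R a + t *\<^sub>R b) b"
    by blast
  show ?thesis
    using s t by (intro that[of s t]) (auto simp: g_def algebra_simps)
qed

lemma second_derivative_symmetric_real:
  fixes f :: "'a::real_normed_vector \<Rightarrow> real"
  assumes "open S" "x \<in> S"
    and f: "\<And>y. y \<in> S \<Longrightarrow> (f has_derivative f' y) (at y)"
    and fa: "\<And>y. y \<in> S \<Longrightarrow> ((\<lambda>y. f' y a) has_derivative fa y) (at y)"
    and fb: "\<And>y. y \<in> S \<Longrightarrow> ((\<lambda>y. f' y b) has_derivative fb y) (at y)"
    and ca: "continuous_on S (\<lambda>y. fa y b)" and cb: "continuous_on S (\<lambda>y. fb y a)"
  shows "fa x b = fb x a"
proof (rule ccontr)
  assume "fa x b \<noteq> fb x a"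
  \<comment> \<open>Half the gap: a number within \<open>e\<close> of \<open>fa x b\<close> cannot
    also be within \<open>e\<close> of \<open>fb x a\<close>.\<close>
  define e where "e = \<bar>fa x b - fb x a\<bar> / 2"
  have e: "e > 0"
    using \<open>fa x b \<noteq> fb x a\<close> by (simp add: e_def)
  obtain d1 where d1: "d1 > 0" "\<And>y. y \<in> S \<Longrightarrow> dist y x < d1 \<Longrightarrow> \<bar>fa y b - fa x b\<bar> < e"
    using ca e \<open>x \<in> S\<close> unfolding continuous_on_iff dist_real_def by metis
  obtain d2 where d2: "d2 > 0" "\<And>y. y \<in> S \<Longrightarrow> dist y x < d2 \<Longrightarrow> \<bar>fb y a - fb x a\<bar> < e"
    using cb e \<open>x \<in> S\<close> unfolding continuous_on_iff dist_real_def by metis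
  obtain d3 where d3: "d3 > 0" "ball x d3 \<subseteq> S"
    using \<open>open S\<close> \<open>x \<in> S\<close> openE by blast
  define d where "d = min d1 (min d2 d3)"
  \<comment> \<open>Scaled so that the parallelogram spanned by \<open>h *\<^sub>R a\<close> and
    \<open>h *\<^sub>R b\<close> stays within distance \<open>d\<close> of \<open>x\<close>; the
    summand 1 keeps the denominator positive even for zero vectors.\<close>
  define h where "h = d / (norm a + norm b + 1)"
  have pos: "d > 0" "h > 0"
    using d1 d2 d3 by (auto simp: d_def h_def add_nonneg_pos)
  have small: "dist (x + s *\<^sub>R a + t *\<^sub>R b) x < d" if "0 \<le> s" "s \<le> h" "0 \<le> t" "t \<le> h" for s t
  proof -
    have "norm (s *\<^sub>R a + t *\<^sub>R b) \<le> s * norm a + t * norm b"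
      using that norm_triangle_ineq[of "s *\<^sub>R a" "t *\<^sub>R b"] by simp
    also have "\<dots> \<le> h * norm a + h * norm b"
      using that by (intro add_mono mult_right_mono) auto
    also have "\<dots> < h * (norm a + norm b + 1)"
      using pos by (simp add: algebra_simps)
    also have "\<dots> = d"
      by (simp add: h_def add_nonneg_pos less_imp_neq[THEN not_sym])
    finally show ?thesis
      by (simp add: dist_norm add.assoc)
  qed
  have inS: "x + s *\<^sub>R a + t *\<^sub>R b \<in> S" if "0 \<le> s" "s \<le> h" "0 \<le> t" "t \<le> h" for s t
    using small[OF that] d3 by (auto simp: d_def dist_commute)
  have inS': "x + s *\<^sub>R b + t *\<^sub>R a \<in> S" if "0 \<le> s" "s \<le> h" "0 \<le> t" "t \<le> h" for s t
    using inS[OF that(3,4,1,2)] by (simp add: algebra_simps)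
  obtain s t where st: "0 \<le> s" "s \<le> h" "0 \<le> t" "t \<le> h"
    "f (x + h *\<^sub>R a + h *\<^sub>R b) - f (x + h *\<^sub>R a) - f (x + h *\<^sub>R b) + f x =
      h * h * fa (x + s *\<^sub>R a + t *\<^sub>R b) b"
    using second_difference_mvt[OF inS f fa \<open>h > 0\<close>] by blast
  obtain s' t' where st': "0 \<le> s'" "s' \<le> h" "0 \<le> t'" "t' \<le> h"
    "f (x + h *\<^sub>R b + h *\<^sub>R a) - f (x + h *\<^sub>R b) - f (x + h *\<^sub>R a) + f x =
      h * h * fb (x + s' *\<^sub>R b + t' *\<^sub>R a) a"
    using second_difference_mvt[OF inS' f fb \<open>h > 0\<close>] by blast
  have "h * h * fa (x + s *\<^sub>R a + t *\<^sub>R b) b = h * h * fb (x + t' *\<^sub>R a + s' *\<^sub>R b) a"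
    using st(5) st'(5) by (simp add: algebra_simps)
  then have "fa (x + s *\<^sub>R a + t *\<^sub>R b) b = fb (x + t' *\<^sub>R a + s' *\<^sub>R b) a"
    using \<open>h > 0\<close> by simp
  moreover have "\<bar>fa (x + s *\<^sub>R a + t *\<^sub>R b) b - fa x b\<bar> < e"
    using small[OF st(1-4)] inS[OF st(1-4)] by (intro d1) (auto simp: d_def)
  moreover have "\<bar>fb (x + t' *\<^sub>R a + s' *\<^sub>R b) a - fb x a\<bar> < e"
    using small[OF st'(3,4,1,2)] inS[OF st'(3,4,1,2)] by (intro d2) (auto simp: d_def)
  ultimately show False
    unfolding e_def by (auto simp: field_simps abs_if split: if_splits)
qed

text \<open>The mean value theorem concerns real functions, so the symmetry is obtained coordinate
  by coordinate.\<close>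

lemma dderiv2_symmetric:
  fixes f :: "'a::real_normed_vector \<Rightarrow> 'b::euclidean_space"
  assumes "open S" "smooth_on S f" "x \<in> S"
  shows "dderiv2 f x a b = dderiv2 f x b a"
proof (rule euclidean_eqI)
  fix i :: 'b
  have c: "continuous_on S (\<lambda>y. dderiv2 f y a b)" for a b
    unfolding dderiv2_def using assms by (intro smooth_on_imp_continuous_on smooth_on_dderiv)
  have d1: "((\<lambda>y. f y \<bullet> i) has_derivative (\<lambda>c. dderiv f y c \<bullet> i)) (at y)" if "y \<in> S" for y
    using that by (intro has_derivative_inner_left smooth_on_has_derivative[OF assms(2)])
  have d2: "((\<lambda>y. dderiv f y c \<bullet> i) has_derivative (\<lambda>d. dderiv2 f y d c \<bullet> i)) (at y)"
    if "y \<in> S" for y c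
    using that by (intro has_derivative_inner_left smooth_on_has_derivative2[OF assms(2)])
  have c': "continuous_on S (\<lambda>y. dderiv2 f y c d \<bullet> i)" for c d
    by (intro continuous_on_inner c continuous_on_const)
  show "dderiv2 f x a b \<bullet> i = dderiv2 f x b a \<bullet> i"
    by (rule second_derivative_symmetric_real[where S = S and f' = "\<lambda>y c. dderiv f y c \<bullet> i"
          and fa = "\<lambda>y d. dderiv2 f y d b \<bullet> i" and fb = "\<lambda>y d. dderiv2 f y d a \<bullet> i"])
      (use assms d1 d2 c' in auto)
qed

section \<open>Lifting smooth maps through immersions\<close>

text \<open>Applying a left inverse \<open>L\<close> of \<open>D\<close> writes the increment of
  \<open>g\<close> as \<open>L (F' (x - u))\<close> plus \<open>L\<close> of two Taylor remainders.
  The remainder of \<open>\<psi>\<close> is small only relative to the unknown increment of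
  \<open>g\<close>. Continuity makes it absorbable, which first bounds that increment linearly in
  \<open>x - u\<close> and then makes the whole error small.\<close>

lemma lift_has_derivative:
  fixes g :: "'a::real_normed_vector \<Rightarrow> 'b::euclidean_space" and \<psi> :: "'b \<Rightarrow> 'c::euclidean_space"
  assumes "continuous (at u) g" "(\<psi> has_derivative D) (at (g u))" "inj D"
    and S: "open S" "u \<in> S" "\<And>x. x \<in> S \<Longrightarrow> \<psi> (g x) = F x"
    and F: "(F has_derivative F') (at u)"
  obtains L where "(g has_derivative (\<lambda>h. L (F' h))) (at u)"
proof -
  have "linear D"
    using assms(2) has_derivative_linear by blast
  obtain L where L: "linear L" "L \<circ> D = id"
    using linear_injective_left_inverse[OF \<open>linear D\<close> \<open>inj D\<close>] by blast
  then have bL: "bounded_linear L"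
    by (simp add: linear_conv_bounded_linear)
  have bF: "bounded_linear F'"
    using F has_derivative_bounded_linear by blast
  obtain K where K: "K > 0" "\<And>y. norm (L y) \<le> norm y * K"
    using bounded_linear.pos_bounded[OF bL] by blast
  obtain M where M: "M > 0" "\<And>y. norm (F' y) \<le> norm y * M"
    using bounded_linear.pos_bounded[OF bF] by blast
  have "\<exists>d>0. \<forall>x. norm (x - u) < d \<longrightarrow> norm (g x - g u - L (F' (x - u))) \<le> e * norm (x - u)"
    if "e > 0" for e
  proof -
    \<comment> \<open>The bound \<open>1 / (2 * K)\<close> allows half of the increment of
      \<open>g\<close> to be absorbed; the other bound makes the remainder of \<open>\<psi>\<close>
      cost at most \<open>e / 2\<close> once the increment is bounded with constant
      \<open>2 * K * (M + 1)\<close>.\<close>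
    define e1 where "e1 = min (1 / (2 * K)) (e / (4 * K * K * (M + 1)))"
    define e2 where "e2 = min 1 (e / (2 * K))"
    have e12: "e1 > 0" "e2 > 0" "e2 \<le> 1" "K * e2 \<le> e / 2" "K * e1 \<le> 1 / 2"
      "K * e1 * (2 * K * (M + 1)) \<le> e / 2"
    proof -
      show "K * e1 \<le> 1 / 2"
        using K mult_left_mono[of e1 "1 / (2 * K)" K] by (simp add: e1_def)
      show "K * e2 \<le> e / 2"
        using K mult_left_mono[of e2 "e / (2 * K)" K] by (simp add: e2_def)
      have "e1 * (2 * K * K * (M + 1)) \<le> (e / (4 * K * K * (M + 1))) * (2 * K * K * (M + 1))"
        using K M by (intro mult_right_mono) (auto simp: e1_def)
      also have "\<dots> = e / 2"
        using K M by (simp add: field_simps add_nonneg_eq_0_iff)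
      finally show "K * e1 * (2 * K * (M + 1)) \<le> e / 2"
        by (simp add: algebra_simps)
    qed (use K M that in \<open>auto simp: e1_def e2_def intro!: divide_pos_pos mult_pos_pos\<close>)
    obtain d1 where d1: "d1 > 0"
      "\<And>y. norm (y - g u) < d1 \<Longrightarrow> norm (\<psi> y - \<psi> (g u) - D (y - g u)) \<le> e1 * norm (y - g u)"
      using assms(2) e12(1) unfolding has_derivative_at_alt by blast
    obtain d2 where d2: "d2 > 0"
      "\<And>x. norm (x - u) < d2 \<Longrightarrow> norm (F x - F u - F' (x - u)) \<le> e2 * norm (x - u)"
      using F e12(2) unfolding has_derivative_at_alt by blast
    obtain d3 where d3: "d3 > 0" "\<And>x. norm (x - u) < d3 \<Longrightarrow> norm (g x - g u) < d1"
      using assms(1) d1(1) unfolding continuous_at_eps_delta dist_norm by blast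
    obtain d4 where d4: "d4 > 0" "ball u d4 \<subseteq> S"
      using S openE by blast
    show ?thesis
    proof (intro exI[of _ "min d2 (min d3 d4)"] conjI allI impI)
      show "0 < min d2 (min d3 d4)"
        using d2 d3 d4 by simp
      fix x
      assume x: "norm (x - u) < min d2 (min d3 d4)"
      then have "x \<in> S"
        using d4 by (auto simp: dist_norm norm_minus_commute)
      define r1 where "r1 = \<psi> (g x) - \<psi> (g u) - D (g x - g u)"
      define r2 where "r2 = F x - F u - F' (x - u)"
      have r1: "norm r1 \<le> e1 * norm (g x - g u)"
        unfolding r1_def using x by (intro d1 d3) simp
      have r2: "norm r2 \<le> e2 * norm (x - u)"
        unfolding r2_def using x by (intro d2) simp
      have LD: "L (D y) = y" for y
        using L(2) by (metis comp_apply id_apply)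
      have "D (g x - g u) = F' (x - u) + (r2 - r1)"
        using S(3)[OF \<open>x \<in> S\<close>] S(3)[OF S(2)] by (simp add: r1_def r2_def)
      then have "g x - g u = L (F' (x - u) + (r2 - r1))"
        by (metis LD)
      then have eq: "g x - g u = L (F' (x - u)) + L (r2 - r1)"
        by (simp add: linear_add[OF L(1)])
      have rem: "norm (L (r2 - r1)) \<le> K * e2 * norm (x - u) + K * e1 * norm (g x - g u)"
      proof -
        have "norm (L (r2 - r1)) \<le> norm (r2 - r1) * K"
          by (rule K)
        also have "\<dots> \<le> (e2 * norm (x - u) + e1 * norm (g x - g u)) * K"
          using K r1 r2 norm_triangle_ineq4[of r2 r1] by (intro mult_right_mono) auto
        finally show ?thesis
          by (simp add: algebra_simps)
      qed
      have LF: "norm (L (F' (x - u))) \<le> K * M * norm (x - u)"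
      proof -
        have "norm (L (F' (x - u))) \<le> norm (F' (x - u)) * K"
          by (rule K)
        also have "\<dots> \<le> norm (x - u) * M * K"
          using K M by (intro mult_right_mono) auto
        finally show ?thesis
          by (simp add: algebra_simps)
      qed
      have "norm (g x - g u) \<le> norm (L (F' (x - u))) + norm (L (r2 - r1))"
        unfolding eq by (rule norm_triangle_ineq)
      also have "\<dots> \<le> K * M * norm (x - u) + (K * norm (x - u) + 1 / 2 * norm (g x - g u))"
      proof -
        have "K * e2 * norm (x - u) \<le> K * 1 * norm (x - u)"
          using K e12 by (intro mult_right_mono mult_left_mono) auto
        moreover have "K * e1 * norm (g x - g u) \<le> 1 / 2 * norm (g x - g u)"
          using e12 by (intro mult_right_mono) auto
        ultimately show ?thesis
          using rem LF by linarith
      qed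
      finally have "norm (g x - g u) \<le> 2 * K * (M + 1) * norm (x - u)"
        by (simp add: algebra_simps)
      then have "K * e1 * norm (g x - g u) \<le> K * e1 * (2 * K * (M + 1) * norm (x - u))"
        using K e12 by (intro mult_left_mono) auto
      also have "\<dots> = (K * e1 * (2 * K * (M + 1))) * norm (x - u)"
        by simp
      also have "\<dots> \<le> e / 2 * norm (x - u)"
        using e12(6) by (intro mult_right_mono) auto
      finally have "K * e1 * norm (g x - g u) \<le> e / 2 * norm (x - u)" .
      moreover have "K * e2 * norm (x - u) \<le> e / 2 * norm (x - u)"
        using e12 by (intro mult_right_mono) auto
      ultimately show "norm (g x - g u - L (F' (x - u))) \<le> e * norm (x - u)"
        using rem by (simp add: eq)
    qed
  qed
  then have "(g has_derivative (\<lambda>h. L (F' h))) (at u)"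
    unfolding has_derivative_at_alt
    using bounded_linear_compose[OF bL bF] by blast
  then show ?thesis
    by (rule that)
qed

text \<open>Injectivity at \<open>u\<close> gives \<open>M u\<close> a lower bound \<open>m\<close>;
  once \<open>M x\<close> is within \<open>m / 2\<close> of \<open>M u\<close>, the deviation of
  \<open>w x\<close> from \<open>w u\<close> is controlled by data tending to 0. It supplies
  continuity of the derivative of a lift, which solves a linear system with coefficients
  \<open>dderiv \<psi> (g x)\<close>.\<close>

lemma continuous_solution_injective_linear_family:
  fixes M :: "'a::t2_space \<Rightarrow> 'b::euclidean_space \<Rightarrow> 'c::euclidean_space"
  assumes S: "open S" "u \<in> S" and lin: "\<And>x. x \<in> S \<Longrightarrow> linear (M x)"
    and cont: "\<And>i. continuous (at u) (\<lambda>x. M x i)" "continuous (at u) r"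
    and "inj (M u)" and sol: "\<And>x. x \<in> S \<Longrightarrow> M x (w x) = r x"
  shows "continuous (at u) w"
proof -
  obtain m where m: "m > 0" "\<And>y. m * norm y \<le> norm (M u y)"
    using linear_inj_bounded_below_pos[OF lin[OF S(2)] \<open>inj (M u)\<close>] by blast
  \<comment> \<open>An upper bound for the operator norm of \<open>M x - M u\<close>; it tends to 0
    because only finitely many basis directions enter.\<close>
  define \<delta> where "\<delta> x = (\<Sum>i\<in>Basis. norm (M x i - M u i))" for x
  have \<delta>0: "(\<delta> \<longlongrightarrow> 0) (at u)"
  proof -
    have "((\<lambda>x. norm (M x i - M u i)) \<longlongrightarrow> norm (M u i - M u i)) (at u)" for i
      using cont(1)[of i] unfolding continuous_at by (intro tendsto_intros)
    then have "(\<delta> \<longlongrightarrow> (\<Sum>i\<in>Basis. norm (M u i - M u i))) (at u)"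
      unfolding \<delta>_def by (intro tendsto_sum)
    then show ?thesis
      by simp
  qed
  have \<delta>: "norm (M x y - M u y) \<le> \<delta> x * norm y" if "x \<in> S" for x y
  proof -
    have "M x y - M u y = (\<Sum>i\<in>Basis. (y \<bullet> i) *\<^sub>R (M x i - M u i))"
      using linear_euclidean_expand[OF lin[OF that], of y]
        linear_euclidean_expand[OF lin[OF S(2)], of y]
      by (simp add: sum_subtractf scaleR_diff_right)
    also have "norm \<dots> \<le> (\<Sum>i\<in>Basis. norm (M x i - M u i) * norm y)"
      by (rule sum_norm_le)
        (simp add: mult.commute[of _ "norm y"] mult_right_mono Basis_le_norm)
    finally show ?thesis
      by (simp add: \<delta>_def sum_distrib_right)
  qed
  have "((\<lambda>x. w x - w u) \<longlongrightarrow> 0) (at u)"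
  proof (rule Lim_null_comparison)
    have "eventually (\<lambda>x. x \<in> S) (at u)"
      using S by (auto simp: eventually_at_topological)
    moreover have "eventually (\<lambda>x. \<delta> x < m / 2) (at u)"
      using order_tendstoD(2)[OF \<delta>0, of "m / 2"] m by simp
    ultimately show "\<forall>\<^sub>F x in at u. norm (w x - w u) \<le> 2 / m * (norm (r x - r u) + \<delta> x * norm (w u))"
    proof eventually_elim
      case (elim x)
      have "M u (w x - w u) = (r x - r u) - (M x (w x) - M u (w x))"
        using sol[OF \<open>x \<in> S\<close>] sol[OF S(2)] by (simp add: linear_diff[OF lin[OF S(2)]])
      then have "m * norm (w x - w u) \<le> norm ((r x - r u) - (M x (w x) - M u (w x)))"
        using m(2)[of "w x - w u"] by simp
      also have "\<dots> \<le> norm (r x - r u) + norm (M x (w x) - M u (w x))"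
        by (rule norm_triangle_ineq4)
      also have "\<dots> \<le> norm (r x - r u) + \<delta> x * norm (w x)"
        using \<delta>[OF \<open>x \<in> S\<close>] by simp
      also have "\<dots> \<le> norm (r x - r u) + \<delta> x * (norm (w u) + norm (w x - w u))"
        using norm_triangle_sub[of "w x" "w u"]
        by (intro add_left_mono mult_left_mono) (auto simp: \<delta>_def intro: sum_nonneg)
      also have "\<dots> \<le> norm (r x - r u) + \<delta> x * norm (w u) + m / 2 * norm (w x - w u)"
        using elim(2) mult_right_mono[of "\<delta> x" "m / 2" "norm (w x - w u)"]
        by (simp add: algebra_simps)
      finally show ?case
        using m by (simp add: field_simps)
    qed
    have "((\<lambda>x. 2 / m * (norm (r x - r u) + \<delta> x * norm (w u))) \<longlongrightarrow>
        2 / m * (norm (r u - r u) + 0 * norm (w u))) (at u)"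
      using cont(2) \<delta>0 unfolding continuous_at by (intro tendsto_intros)
    then show "((\<lambda>x. 2 / m * (norm (r x - r u) + \<delta> x * norm (w u))) \<longlongrightarrow> 0) (at u)"
      by simp
  qed
  then show ?thesis
    using LIM_zero_cancel by (auto simp: continuous_at)
qed

text \<open>The second derivative of the lift is found by lifting once more, through \<open>tangent_map \<psi>\<close>.\<close>

lemma lift_derivatives:
  fixes g :: "'a::euclidean_space \<Rightarrow> 'b::euclidean_space" and \<psi> :: "'b \<Rightarrow> 'c::euclidean_space"
  assumes V: "open V" "smooth_on V \<psi>" "\<And>v. v \<in> V \<Longrightarrow> inj (dderiv \<psi> v)"
    and S: "open S" "smooth_on S F" "continuous_on S g" "g ` S \<subseteq> V"
    and lift: "\<And>x. x \<in> S \<Longrightarrow> \<psi> (g x) = F x" and "u \<in> S"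
  shows "g differentiable (at u)"
    and "(\<lambda>x. dderiv g x b) differentiable (at u)"
    and "dderiv F u a = dderiv \<psi> (g u) (dderiv g u a)"
    and "dderiv2 F u a b =
      dderiv2 \<psi> (g u) (dderiv g u a) (dderiv g u b) + dderiv \<psi> (g u) (dderiv2 g u a b)"
proof -
  have cont: "continuous (at x) g" if "x \<in> S" for x
    using S(1,3) that by (simp add: continuous_on_eq_continuous_at)
  have gV: "g x \<in> V" if "x \<in> S" for x
    using S(4) that by blast
  have diff: "g differentiable (at x)" if "x \<in> S" for x
    using lift_has_derivative[OF cont[OF that] smooth_on_has_derivative[OF V(2) gV[OF that]]
        V(3)[OF gV[OF that]] S(1) that lift smooth_on_has_derivative[OF S(2) that]]
      differentiableI by metis
  have D1: "dderiv F x a = dderiv \<psi> (g x) (dderiv g x a)" if "x \<in> S" for x a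
  proof -
    have "((\<lambda>x. \<psi> (g x)) has_derivative (\<lambda>a. dderiv \<psi> (g x) (dderiv g x a))) (at x)"
      by (rule has_derivative_compose[OF differentiable_has_dderiv[OF diff[OF that]]
          smooth_on_has_derivative[OF V(2) gV[OF that]]])
    from dderiv_eqI[OF this] show ?thesis
      using dderiv_cong_open[OF S(1) that lift] by simp
  qed
  show "g differentiable (at u)" "dderiv F u a = dderiv \<psi> (g u) (dderiv g u a)"
    using diff D1 \<open>u \<in> S\<close> by auto
  have gu: "g u \<in> V"
    using gV \<open>u \<in> S\<close> by blast
  \<comment> \<open>\<open>lift_has_derivative\<close> presupposes continuity of the lift. The
    second component of the lift through \<open>tangent_map \<psi>\<close> is so far just a
    derivative, with no continuity known.\<close>
  have cont_w: "continuous (at u) (\<lambda>x. dderiv g x b)"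
  proof (rule continuous_solution_injective_linear_family
      [where M = "\<lambda>x. dderiv \<psi> (g x)", OF S(1) \<open>u \<in> S\<close>])
    show "linear (dderiv \<psi> (g x))" if "x \<in> S" for x
      by (rule smooth_on_linear_dderiv[OF V(2) gV[OF that]])
    show "continuous (at u) (\<lambda>x. dderiv \<psi> (g x) i)" for i
    proof (rule continuous_at_compose[OF cont[OF \<open>u \<in> S\<close>], of "\<lambda>y. dderiv \<psi> y i", unfolded o_def])
      show "continuous (at (g u)) (\<lambda>y. dderiv \<psi> y i)"
        using smooth_on_imp_continuous_on[OF smooth_on_dderiv[OF V(2)]] V(1) gu
        by (simp add: continuous_on_eq_continuous_at)
    qed
    show "continuous (at u) (\<lambda>x. dderiv F x b)"
      using smooth_on_imp_continuous_on[OF smooth_on_dderiv[OF S(2)]] S(1) \<open>u \<in> S\<close>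
      by (simp add: continuous_on_eq_continuous_at)
    show "inj (dderiv \<psi> (g u))"
      by (rule V(3)[OF gu])
  qed (simp add: D1)
  define G where "G x = (g x, dderiv g x b)" for x
  let ?D = "dderiv (tangent_map \<psi>) (G u)"
  have D: "(tangent_map \<psi> has_derivative ?D) (at (G u))"
    by (rule smooth_on_has_derivative[OF smooth_on_tangent_map[OF V(1,2)]])
      (simp add: G_def gu)
  have De: "?D (y, z) = (dderiv \<psi> (g u) y, dderiv2 \<psi> (g u) y (dderiv g u b) + dderiv \<psi> (g u) z)" for y z
    unfolding G_def by (rule dderiv_tangent_map[OF V(1,2) gu])
  have "linear (dderiv \<psi> (g u))"
    by (rule smooth_on_linear_dderiv[OF V(2) gu])
  have ker: "y = 0" if "dderiv \<psi> (g u) y = 0" for y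
    using V(3)[OF gu] \<open>linear (dderiv \<psi> (g u))\<close> that by (simp add: linear_injective_0)
  \<comment> \<open>\<open>?D\<close> is block triangular with \<open>dderiv \<psi> (g u)\<close> as
    both diagonal blocks, so its kernel is trivial.\<close>
  have "inj ?D"
    unfolding linear_injective_0[OF has_derivative_linear[OF D]]
  proof (intro allI impI)
    fix z
    assume "?D z = 0"
    then have "dderiv \<psi> (g u) (fst z) = 0"
      and 2: "dderiv2 \<psi> (g u) (fst z) (dderiv g u b) + dderiv \<psi> (g u) (snd z) = 0"
      using De[of "fst z" "snd z"] by (auto simp: zero_prod_def)
    then have "fst z = 0"
      by (simp add: ker)
    moreover have "dderiv2 \<psi> (g u) 0 (dderiv g u b) = 0"
      using linear_0[OF smooth_on_linear_dderiv[OF smooth_on_dderiv[OF V(2)] gu]]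
      by (simp add: dderiv2_def)
    ultimately show "z = 0"
      using 2 by (simp add: ker prod_eq_iff)
  qed
  have FF: "((\<lambda>x. (F x, dderiv F x b)) has_derivative (\<lambda>a. (dderiv F u a, dderiv2 F u a b))) (at u)"
    by (rule has_derivative_Pair[OF smooth_on_has_derivative[OF S(2) \<open>u \<in> S\<close>]
          smooth_on_has_derivative2[OF S(2) \<open>u \<in> S\<close>]])
  have GF: "tangent_map \<psi> (G x) = (F x, dderiv F x b)" if "x \<in> S" for x
    using lift[OF that] D1[OF that] by (simp add: G_def tangent_map_def)
  have "continuous (at u) G"
    unfolding G_def using cont[OF \<open>u \<in> S\<close>] cont_w by (rule continuous_Pair)
  from lift_has_derivative[OF this D \<open>inj ?D\<close> S(1) \<open>u \<in> S\<close> GF FF]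
  have G: "G differentiable (at u)"
    using differentiableI by metis
  have "(\<lambda>x. snd (G x)) differentiable (at u)"
    using G bounded_linear.has_derivative[OF bounded_linear_snd] unfolding differentiable_def by blast
  then show w: "(\<lambda>x. dderiv g x b) differentiable (at u)"
    by (simp add: G_def)
  have "(G has_derivative (\<lambda>a. (dderiv g u a, dderiv2 g u a b))) (at u)"
    unfolding G_def dderiv2_def
    by (rule has_derivative_Pair[OF differentiable_has_dderiv[OF diff[OF \<open>u \<in> S\<close>]]
          differentiable_has_dderiv[OF w]])
  from has_derivative_compose[OF this D]
  have "((\<lambda>x. tangent_map \<psi> (G x)) has_derivative (\<lambda>a. ?D (dderiv g u a, dderiv2 g u a b))) (at u)" .
  from dderiv_eqI[OF this, symmetric] dderiv_cong_open[OF S(1) \<open>u \<in> S\<close> GF] dderiv_eqI[OF FF]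
  have "(\<lambda>a. ?D (dderiv g u a, dderiv2 g u a b)) = (\<lambda>a. (dderiv F u a, dderiv2 F u a b))"
    by (rule trans[OF trans])
  from fun_cong[OF this, of a]
  have "?D (dderiv g u a, dderiv2 g u a b) = (dderiv F u a, dderiv2 F u a b)" .
  then show "dderiv2 F u a b =
      dderiv2 \<psi> (g u) (dderiv g u a) (dderiv g u b) + dderiv \<psi> (g u) (dderiv2 g u a b)"
    by (simp add: De)
qed

section \<open>Metrics induced from ambient bilinear forms\<close>

text \<open>The map \<open>T\<close> sends \<open>v\<close> to the coefficient vector of the
  functional \<open>g v\<close>; positivity makes it injective, hence surjective by equality of
  dimensions. This resolves both the description in \<open>christoffel\<close> and the dual vectors
  in \<open>metric_trace\<close>.\<close>

lemma riesz_ex1: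
  fixes g :: "'a::euclidean_space \<Rightarrow> 'a \<Rightarrow> real"
  assumes "bilinear g" and pos: "\<And>a. a \<noteq> 0 \<Longrightarrow> g a a > 0" and "linear r"
  shows "\<exists>!v. \<forall>w. g v w = r w"
proof -
  have l: "linear (\<lambda>v. g v w)" and r: "linear (g v)" for v w
    using assms(1) by (auto simp: bilinear_def)
  define T where "T v = (\<Sum>i\<in>Basis. g v i *\<^sub>R i)" for v
  have T: "linear T"
    by (rule linearI) (simp_all add: T_def linear_add[OF l] linear_cmul[OF l] scaleR_add_left
        sum.distrib scaleR_sum_right)
  have Ti: "T v \<bullet> i = g v i" if "i \<in> Basis" for v i
    using that by (simp add: T_def)
  have eq: "g v w = h w" if "linear h" "\<And>i. i \<in> Basis \<Longrightarrow> g v i = h i" for v w and h :: "'a \<Rightarrow> real"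
  proof -
    have "g v = h"
      by (rule linear_eq_stdbasis[OF r that(1)]) (rule that(2))
    then show ?thesis
      by simp
  qed
  have "inj T"
    unfolding linear_injective_0[OF T]
  proof (intro allI impI)
    fix v
    assume "T v = 0"
    then have "g v w = 0" for w
      using eq[OF linear_zero, of v w] by (simp flip: Ti)
    then show "v = 0"
      using pos[of v] by fastforce
  qed
  then have "surj T"
    using linear_injective_imp_surjective[OF T] by simp
  then obtain v where "T v = (\<Sum>i\<in>Basis. r i *\<^sub>R i)"
    by (metis surjD)
  then have "\<forall>w. g v w = r w"
    using eq[OF assms(3), of v] by (simp flip: Ti)
  moreover have "v' = v" if "\<forall>w. g v' w = r w" "\<forall>w. g v w = r w" for v v'
  proof -
    have "g (v' - v) (v' - v) = 0"
      using that by (simp add: linear_diff[OF l])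
    then show ?thesis
      using pos[of "v' - v"] by fastforce
  qed
  ultimately show ?thesis
    by blast
qed

text \<open>Smoothness is required jointly in the base point and both vectors, so that a form
  evaluated along moving vectors can be differentiated by the chain rule. Positivity is left to
  \<open>ambient_chart\<close>, where it concerns tangent vectors only.\<close>

locale ambient_metric =
  fixes H :: "'b::euclidean_space metric_field"
  assumes bilinear: "bilinear (H y)"
    and symmetric: "H y A B = H y B A"
    and smooth: "smooth_on UNIV (\<lambda>z. H (fst z) (fst (snd z)) (snd (snd z)))"
begin

definition DH :: "'b \<Rightarrow> 'b \<Rightarrow> 'b \<Rightarrow> 'b \<Rightarrow> real"
  where "DH y C A B = dderiv (\<lambda>y. H y A B) y C"

lemma linear_H_right: "linear (H y A)" and linear_H_left: "linear (\<lambda>A. H y A B)"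
  using bilinear[of y] by (auto simp: bilinear_def)

lemma has_derivative_H_base: "((\<lambda>y. H y A B) has_derivative (\<lambda>C. DH y C A B)) (at y)"
proof -
  have "((\<lambda>y. (y, A, B)) has_derivative (\<lambda>C. (C, 0, 0))) (at y)"
    by (intro has_derivative_Pair has_derivative_ident has_derivative_const)
  from has_derivative_compose[OF this smooth_on_has_derivative[OF smooth UNIV_I]]
  have "(\<lambda>y. H y A B) differentiable (at y)"
    by (auto simp: differentiable_def)
  then show ?thesis
    unfolding DH_def by (rule differentiable_has_dderiv)
qed

lemma linear_DH: "linear (\<lambda>C. DH y C A B)"
  using has_derivative_H_base has_derivative_linear by blast

lemma linear_DH_right: "linear (DH y C A)"
proof
  show "DH y C A (b1 + b2) = DH y C A b1 + DH y C A b2" for b1 b2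
    using dderiv_eqI[OF has_derivative_add[OF has_derivative_H_base[of A b1 y] has_derivative_H_base[of A b2 y]]]
    by (simp add: DH_def linear_add[OF linear_H_right])
  show "DH y C A (r *\<^sub>R b) = r *\<^sub>R DH y C A b" for r b
    using dderiv_eqI[OF has_derivative_scaleR_right[OF has_derivative_H_base[of A b y], of r]]
    by (simp add: DH_def linear_cmul[OF linear_H_right])
qed

text \<open>Joint smoothness provides a total derivative; restricting it to the three factors
  identifies it as \<open>DH\<close> in the base point and as \<open>H\<close> itself in each linear
  argument.\<close>

lemma has_derivative_H:
  assumes \<psi>: "(\<psi> has_derivative \<psi>') (at w)" and A: "(A has_derivative A') (at w)"
    and B: "(B has_derivative B') (at w)"
  shows "((\<lambda>w. H (\<psi> w) (A w) (B w)) has_derivative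
    (\<lambda>c. DH (\<psi> w) (\<psi>' c) (A w) (B w) + H (\<psi> w) (A' c) (B w) + H (\<psi> w) (A w) (B' c))) (at w)"
proof -
  define h where "h z = H (fst z) (fst (snd z)) (snd (snd z))" for z
  have h: "h (x, y, z) = H x y z" for x y z
    by (simp add: h_def)
  let ?T = "dderiv h (\<psi> w, A w, B w)"
  have T: "(h has_derivative ?T) (at (\<psi> w, A w, B w))"
    using smooth_on_has_derivative[OF smooth UNIV_I] unfolding h_def .
  have "linear ?T"
    using T has_derivative_linear by blast
  have "((\<lambda>y. h (y, A w, B w)) has_derivative (\<lambda>C. ?T (C, 0, 0))) (at (\<psi> w))"
    by (rule has_derivative_compose[OF has_derivative_Pair[OF has_derivative_ident
          has_derivative_Pair[OF has_derivative_const has_derivative_const]] T])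
  note 1 = fun_cong[OF has_derivative_unique[OF this[unfolded h] has_derivative_H_base]]
  have "((\<lambda>y. h (\<psi> w, y, B w)) has_derivative (\<lambda>C. ?T (0, C, 0))) (at (A w))"
    by (rule has_derivative_compose[OF has_derivative_Pair[OF has_derivative_const
          has_derivative_Pair[OF has_derivative_ident has_derivative_const]] T])
  note 2 = fun_cong[OF has_derivative_unique[OF this[unfolded h] linear_imp_has_derivative[OF linear_H_left]]]
  have "((\<lambda>y. h (\<psi> w, A w, y)) has_derivative (\<lambda>C. ?T (0, 0, C))) (at (B w))"
    by (rule has_derivative_compose[OF has_derivative_Pair[OF has_derivative_const
          has_derivative_Pair[OF has_derivative_const has_derivative_ident]] T])
  note 3 = fun_cong[OF has_derivative_unique[OF this[unfolded h] linear_imp_has_derivative[OF linear_H_right]]]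
  have "?T (x, y, z) = DH (\<psi> w) x (A w) (B w) + H (\<psi> w) y (B w) + H (\<psi> w) (A w) z" for x y z
    using linear_add[OF \<open>linear ?T\<close>, of "(x, 0, 0)" "(0, y, z)"]
      linear_add[OF \<open>linear ?T\<close>, of "(0, y, 0)" "(0, 0, z)"]
    by (simp add: 1 2 3)
  with has_derivative_compose[OF has_derivative_Pair[OF \<psi> has_derivative_Pair[OF A B]] T]
  show ?thesis
    by (simp add: h)
qed

lemma smooth_on_H:
  assumes "open S" "smooth_on S \<psi>" "smooth_on S A" "smooth_on S B"
  shows "smooth_on S (\<lambda>w. H (\<psi> w) (A w) (B w))"
  using smooth_on_compose[OF smooth open_UNIV smooth_on_Pair[OF assms(1,2) smooth_on_Pair[OF assms(1,3,4)]] assms(1)]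
  by simp

end

text \<open>\<open>G_eq\<close> is an assumption rather than the definition of \<open>G\<close>
  because the Cheeger-Gromoll metric is built from the connection map and matches an ambient form on
  tangent vectors only.\<close>

locale ambient_chart = ambient_metric H for H :: "'b::euclidean_space metric_field" +
  fixes V :: "'e::euclidean_space set" and \<psi> :: "'e \<Rightarrow> 'b" and G :: "'e metric_field"
  assumes open_V: "open V" and smooth_\<psi>: "smooth_on V \<psi>"
    and inj_\<psi>: "w \<in> V \<Longrightarrow> inj (dderiv \<psi> w)"
    and pos_H: "w \<in> V \<Longrightarrow> a \<noteq> 0 \<Longrightarrow> H (\<psi> w) (dderiv \<psi> w a) (dderiv \<psi> w a) > 0"
    and G_eq: "w \<in> V \<Longrightarrow> G w a b = H (\<psi> w) (dderiv \<psi> w a) (dderiv \<psi> w b)"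
begin

lemma linear_d\<psi>: "w \<in> V \<Longrightarrow> linear (dderiv \<psi> w)"
  by (rule smooth_on_linear_dderiv[OF smooth_\<psi>])

lemma bilinear_G:
  assumes "w \<in> V"
  shows "bilinear (G w)"
proof -
  have "G w = (\<lambda>a b. H (\<psi> w) (dderiv \<psi> w a) (dderiv \<psi> w b))"
    using G_eq[OF assms] by (simp add: fun_eq_iff)
  then show ?thesis
    using linear_compose[OF linear_d\<psi>[OF assms] linear_H_right]
      linear_compose[OF linear_d\<psi>[OF assms] linear_H_left]
    by (simp add: bilinear_def o_def)
qed

lemma G_symmetric: "w \<in> V \<Longrightarrow> G w a b = G w b a"
  by (simp add: G_eq symmetric)

lemma G_pos: "w \<in> V \<Longrightarrow> a \<noteq> 0 \<Longrightarrow> G w a a > 0"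
  by (simp add: G_eq pos_H)

lemma smooth_G: "smooth_on V (\<lambda>w. G w a b)"
  by (rule smooth_on_cong[OF smooth_on_H[OF open_V smooth_\<psi> smooth_on_dderiv[OF smooth_\<psi>]
          smooth_on_dderiv[OF smooth_\<psi>]] open_V]) (simp add: G_eq)

lemma dderiv_G:
  assumes "w \<in> V"
  shows "dderiv (\<lambda>w. G w a b) w c = DH (\<psi> w) (dderiv \<psi> w c) (dderiv \<psi> w a) (dderiv \<psi> w b)
    + H (\<psi> w) (dderiv2 \<psi> w c a) (dderiv \<psi> w b) + H (\<psi> w) (dderiv \<psi> w a) (dderiv2 \<psi> w c b)"
proof -
  have "dderiv (\<lambda>w. G w a b) w = dderiv (\<lambda>w. H (\<psi> w) (dderiv \<psi> w a) (dderiv \<psi> w b)) w"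
    by (rule dderiv_cong_open[OF open_V assms G_eq])
  then show ?thesis
    using dderiv_eqI[OF has_derivative_H[OF smooth_on_has_derivative[OF smooth_\<psi> assms]
        smooth_on_has_derivative2[OF smooth_\<psi> assms] smooth_on_has_derivative2[OF smooth_\<psi> assms]]]
    by simp
qed

text \<open>The Koszul formula yields six terms with second derivatives of \<open>\<psi>\<close>.
  Symmetry of \<open>dderiv2\<close> and of \<open>H\<close> cancels four of them and merges the
  other two into twice \<open>dderiv2 \<psi> w a b\<close>.\<close>

lemma christoffel_G:
  assumes "w \<in> V"
  shows "2 * H (\<psi> w) (dderiv \<psi> w (christoffel G w a b)) (dderiv \<psi> w c) =
    2 * H (\<psi> w) (dderiv2 \<psi> w a b) (dderiv \<psi> w c)
    + DH (\<psi> w) (dderiv \<psi> w a) (dderiv \<psi> w b) (dderiv \<psi> w c)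
    + DH (\<psi> w) (dderiv \<psi> w b) (dderiv \<psi> w a) (dderiv \<psi> w c)
    - DH (\<psi> w) (dderiv \<psi> w c) (dderiv \<psi> w a) (dderiv \<psi> w b)"
proof -
  \<comment> \<open>Half of the Koszul expression after this cancellation; linearity in
    \<open>c\<close> makes it a functional that \<open>G w\<close> represents uniquely.\<close>
  define r where "r c = H (\<psi> w) (dderiv2 \<psi> w a b) (dderiv \<psi> w c)
    + (DH (\<psi> w) (dderiv \<psi> w a) (dderiv \<psi> w b) (dderiv \<psi> w c)
    + DH (\<psi> w) (dderiv \<psi> w b) (dderiv \<psi> w a) (dderiv \<psi> w c)
    - DH (\<psi> w) (dderiv \<psi> w c) (dderiv \<psi> w a) (dderiv \<psi> w b)) / 2" for c
  note lin = linear_d\<psi>[OF assms]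
  have "linear r"
    by (rule linearI)
      (simp_all add: r_def linear_add[OF lin] linear_add[OF linear_H_right]
        linear_add[OF linear_DH_right] linear_add[OF linear_DH] linear_cmul[OF lin]
        linear_cmul[OF linear_H_right] linear_cmul[OF linear_DH_right] linear_cmul[OF linear_DH]
        add_divide_distrib diff_divide_distrib algebra_simps)
  have koszul: "dderiv (\<lambda>u. G u b c) w a + dderiv (\<lambda>u. G u a c) w b - dderiv (\<lambda>u. G u a b) w c = 2 * r c"
    for c
    unfolding dderiv_G[OF assms] r_def
    by (simp add: dderiv2_symmetric[OF open_V smooth_\<psi> assms, of b a]
        dderiv2_symmetric[OF open_V smooth_\<psi> assms, of c]
        symmetric[of "\<psi> w" "dderiv \<psi> w a"] symmetric[of "\<psi> w" "dderiv \<psi> w b"])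
  have "christoffel G w a b = (THE v. \<forall>c. G w v c = r c)"
    unfolding christoffel_def koszul by simp
  then have "\<forall>c. G w (christoffel G w a b) c = r c"
    using theI'[OF riesz_ex1[OF bilinear_G[OF assms] G_pos[OF assms] \<open>linear r\<close>]] by simp
  then show ?thesis
    by (simp add: G_eq[OF assms] r_def)
qed

text \<open>Differentiating \<open>\<psi> \<circ> f = F\<close> twice contributes
  \<open>- dderiv2 \<psi>\<close>, and \<open>christoffel_G\<close> contributes the same term with
  the opposite sign. After they cancel, \<open>\<psi>\<close> survives only in the test
  vector.\<close>

lemma second_fundamental_form_lift:
  fixes F :: "'c::euclidean_space \<Rightarrow> 'b"
  assumes S: "open S" "smooth_on S F" "continuous_on S f" "f ` S \<subseteq> V"
    and lift: "\<And>x. x \<in> S \<Longrightarrow> \<psi> (f x) = F x" and "u \<in> S"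
  shows "2 * H (F u) (dderiv \<psi> (f u) (second_fundamental_form G0 G f u a b)) (dderiv \<psi> (f u) c) =
    2 * H (F u) (dderiv2 F u a b - dderiv F u (christoffel G0 u a b)) (dderiv \<psi> (f u) c)
    + DH (F u) (dderiv F u a) (dderiv F u b) (dderiv \<psi> (f u) c)
    + DH (F u) (dderiv F u b) (dderiv F u a) (dderiv \<psi> (f u) c)
    - DH (F u) (dderiv \<psi> (f u) c) (dderiv F u a) (dderiv F u b)"
proof -
  note L = lift_derivatives[OF open_V smooth_\<psi> inj_\<psi> S lift \<open>u \<in> S\<close>]
  have fu: "f u \<in> V"
    using S(4) \<open>u \<in> S\<close> by blast
  note lin = linear_d\<psi>[OF fu]
  have "dderiv \<psi> (f u) (second_fundamental_form G0 G f u a b) =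
    (dderiv2 F u a b - dderiv F u (christoffel G0 u a b)) +
    (dderiv \<psi> (f u) (christoffel G (f u) (dderiv f u a) (dderiv f u b))
     - dderiv2 \<psi> (f u) (dderiv f u a) (dderiv f u b))"
    unfolding second_fundamental_form_def dderiv2_def[symmetric]
    by (simp add: linear_add[OF lin] linear_diff[OF lin] L(3,4))
  then have "2 * H (F u) (dderiv \<psi> (f u) (second_fundamental_form G0 G f u a b)) (dderiv \<psi> (f u) c) =
    2 * H (F u) (dderiv2 F u a b - dderiv F u (christoffel G0 u a b)) (dderiv \<psi> (f u) c)
    + 2 * H (F u) (dderiv \<psi> (f u) (christoffel G (f u) (dderiv f u a) (dderiv f u b))) (dderiv \<psi> (f u) c)
    - 2 * H (F u) (dderiv2 \<psi> (f u) (dderiv f u a) (dderiv f u b)) (dderiv \<psi> (f u) c)"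
    by (simp add: linear_add[OF linear_H_left] linear_diff[OF linear_H_left])
  then show ?thesis
    using christoffel_G[OF fu, of "dderiv f u a" "dderiv f u b" c]
    by (simp add: L(3) lift[OF \<open>u \<in> S\<close>])
qed

text \<open>The trace identity is tested with \<open>c\<close> equal to the tension field itself;
  positivity of \<open>H\<close> on tangent vectors then forces it to vanish.\<close>

lemma tension_field_lift_eq_0:
  fixes F :: "'c::euclidean_space \<Rightarrow> 'b" and G0 :: "'c metric_field"
  assumes S: "open S" "smooth_on S F" "continuous_on S f" "f ` S \<subseteq> V"
    and lift: "\<And>x. x \<in> S \<Longrightarrow> \<psi> (f x) = F x" and "u \<in> S"
    and trace: "\<And>c. (\<Sum>i\<in>Basis. let i' = (THE v. \<forall>w. G0 u v w = i \<bullet> w) in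
      2 * H (F u) (dderiv2 F u i i' - dderiv F u (christoffel G0 u i i')) (dderiv \<psi> (f u) c)
      + DH (F u) (dderiv F u i) (dderiv F u i') (dderiv \<psi> (f u) c)
      + DH (F u) (dderiv F u i') (dderiv F u i) (dderiv \<psi> (f u) c)
      - DH (F u) (dderiv \<psi> (f u) c) (dderiv F u i) (dderiv F u i')) = 0"
  shows "tension_field G0 G f u = 0"
proof (rule ccontr)
  assume "tension_field G0 G f u \<noteq> 0"
  define t where "t = tension_field G0 G f u"
  have fu: "f u \<in> V"
    using S(4) \<open>u \<in> S\<close> by blast
  have lin: "linear (\<lambda>y. 2 * H (F u) (dderiv \<psi> (f u) y) (dderiv \<psi> (f u) t))"
    by (rule linearI)
      (simp_all add: linear_add[OF linear_d\<psi>[OF fu]] linear_cmul[OF linear_d\<psi>[OF fu]]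
        linear_add[OF linear_H_left] linear_cmul[OF linear_H_left] algebra_simps)
  have t: "t = (\<Sum>i\<in>Basis. second_fundamental_form G0 G f u i (THE v. \<forall>w. G0 u v w = i \<bullet> w))"
    by (simp add: t_def tension_field_def metric_trace_def)
  have "2 * H (F u) (dderiv \<psi> (f u) t) (dderiv \<psi> (f u) t) =
    (\<Sum>i\<in>Basis. 2 * H (F u) (dderiv \<psi> (f u) (second_fundamental_form G0 G f u i
      (THE v. \<forall>w. G0 u v w = i \<bullet> w))) (dderiv \<psi> (f u) t))"
    unfolding linear_sum[OF lin, symmetric] by (simp flip: t)
  also have "\<dots> = 0"
    using trace[of t] by (simp add: Let_def second_fundamental_form_lift[OF S lift \<open>u \<in> S\<close>])
  finally have "2 * H (F u) (dderiv \<psi> (f u) t) (dderiv \<psi> (f u) t) = 0" .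
  moreover have "H (F u) (dderiv \<psi> (f u) t) (dderiv \<psi> (f u) t) > 0"
    using pos_H[OF fu] \<open>tension_field G0 G f u \<noteq> 0\<close> lift[OF \<open>u \<in> S\<close>] by (simp add: t_def)
  ultimately show False
    by simp
qed

end

section \<open>The sphere and its tangent bundle\<close>

text \<open>The inverse \<open>\<theta>\<close> is smooth on an open set of the ambient space.
  Restricting it gives the homeomorphism, and differentiating \<open>\<theta> (\<phi> u) = u\<close>
  gives injectivity of the derivative.\<close>

lemma local_parametrizationI:
  fixes \<phi> :: "'e::euclidean_space \<Rightarrow> 'a::euclidean_space"
  assumes U: "open U" "smooth_on U \<phi>" and W: "open W" "smooth_on W \<theta>"
    and img: "\<phi> ` U = M \<inter> W" and inv: "\<And>u. u \<in> U \<Longrightarrow> \<theta> (\<phi> u) = u"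
  shows "local_parametrization U \<phi> M"
  unfolding local_parametrization_def
proof (intro conjI ballI U)
  show "openin (top_of_set M) (\<phi> ` U)"
    unfolding img by (rule openin_open_Int[OF W(1)])
  have "homeomorphism U (\<phi> ` U) \<phi> \<theta>"
  proof (rule homeomorphismI)
    show "continuous_on (\<phi> ` U) \<theta>"
      using img by (intro continuous_on_subset[OF smooth_on_imp_continuous_on[OF W(2)]]) blast
  qed (use smooth_on_imp_continuous_on[OF U(2)] in \<open>auto simp: inv\<close>)
  then show "\<exists>\<phi>'. homeomorphism U (\<phi> ` U) \<phi> \<phi>'"
    by blast
  fix u
  assume u: "u \<in> U"
  then have "\<phi> u \<in> W"
    using img by blast
  have "((\<lambda>u. \<theta> (\<phi> u)) has_derivative (\<lambda>a. dderiv \<theta> (\<phi> u) (dderiv \<phi> u a))) (at u)"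
    by (rule has_derivative_compose[OF smooth_on_has_derivative[OF U(2) u]
        smooth_on_has_derivative[OF W(2) \<open>\<phi> u \<in> W\<close>]])
  from dderiv_eqI[OF this] have "dderiv \<theta> (\<phi> u) (dderiv \<phi> u a) = a" for a
    using dderiv_cong_open[OF U(1) u inv] by (simp add: fun_eq_iff)
  then show "inj (dderiv \<phi> u)"
    by (metis injI)
qed

text \<open>The continuous inverse in \<open>local_parametrization\<close> is merely some function,
  while \<open>harmonic_map\<close> uses \<open>inv_into\<close>; the two agree on the image, so
  continuity carries over.\<close>

lemma local_parametrizationD:
  assumes "local_parametrization U \<phi> M"
  shows "open U" "smooth_on U \<phi>" "openin (top_of_set M) (\<phi> ` U)" "u \<in> U \<Longrightarrow> inj (dderiv \<phi> u)"
    "u \<in> U \<Longrightarrow> \<phi> u \<in> M" "inj_on \<phi> U" "continuous_on (\<phi> ` U) (inv_into U \<phi>)"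
proof -
  obtain \<theta> where h: "homeomorphism U (\<phi> ` U) \<phi> \<theta>"
    using assms unfolding local_parametrization_def by blast
  show inj: "inj_on \<phi> U"
    using h unfolding homeomorphism_def by (metis inj_onI)
  show "continuous_on (\<phi> ` U) (inv_into U \<phi>)"
  proof (rule continuous_on_eq)
    show "continuous_on (\<phi> ` U) \<theta>"
      using h by (simp add: homeomorphism_def)
    show "\<theta> y = inv_into U \<phi> y" if "y \<in> \<phi> ` U" for y
      using h that inj unfolding homeomorphism_def by auto
  qed
  show "openin (top_of_set M) (\<phi> ` U)"
    using assms by (simp add: local_parametrization_def)
  then show "u \<in> U \<Longrightarrow> \<phi> u \<in> M"
    using openin_imp_subset by blast
qed (use assms in \<open>auto simp: local_parametrization_def\<close>)

lemma riemannian_manifold_ambientI: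
  fixes M :: "'a::euclidean_space set"
  assumes "submanifold TYPE('e::euclidean_space) M"
    and "\<And>(U::'e set) \<phi>. local_parametrization U \<phi> M \<Longrightarrow> ambient_chart H U \<phi> (pullback_metric g \<phi>)"
  shows "riemannian_manifold TYPE('e) M g"
  unfolding riemannian_manifold_def
  using assms(1) ambient_chart.bilinear_G[OF assms(2)] ambient_chart.G_symmetric[OF assms(2)]
    ambient_chart.G_pos[OF assms(2)] ambient_chart.smooth_G[OF assms(2)]
  by blast

interpretation round: ambient_metric "round_metric :: 'a::euclidean_space metric_field"
proof
  show "bilinear (round_metric y)" for y :: 'a
    by (simp add: bilinear_def round_metric_def inner_add linear_iff)
  show "smooth_on UNIV (\<lambda>z::'a \<times> 'a \<times> 'a. round_metric (fst z) (fst (snd z)) (snd (snd z)))"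
    unfolding round_metric_def
    by (intro smooth_on_inner smooth_on_bounded_linear open_UNIV
        bounded_linear_compose[OF bounded_linear_fst bounded_linear_snd]
        bounded_linear_compose[OF bounded_linear_snd bounded_linear_snd])
qed (simp add: round_metric_def inner_commute)

lemma DH_round: "round.DH y C A B = 0"
  by (simp add: round.DH_def round_metric_def)

text \<open>Differentiating \<open>\<phi> u \<bullet> \<phi> u = 1\<close> gives the orthogonality,
  and differentiating that gives the normal component of the second derivative.\<close>

lemma sphere_chart_identities:
  assumes "local_parametrization U \<phi> (sphere 0 1)" "u \<in> U"
  shows "\<phi> u \<bullet> \<phi> u = 1" "\<phi> u \<bullet> dderiv \<phi> u a = 0"
    "\<phi> u \<bullet> dderiv2 \<phi> u a b = - (dderiv \<phi> u a \<bullet> dderiv \<phi> u b)"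
proof -
  note chart = local_parametrizationD[OF assms(1)]
  have 1: "\<phi> v \<bullet> \<phi> v = 1" if "v \<in> U" for v
    using chart(5)[OF that] by (simp add: dot_square_norm)
  have 2: "\<phi> v \<bullet> dderiv \<phi> v a = 0" if "v \<in> U" for v a
  proof -
    note d = smooth_on_has_derivative[OF chart(2) that]
    have "dderiv (\<lambda>v. \<phi> v \<bullet> \<phi> v) v = dderiv (\<lambda>_. 1) v"
      by (rule dderiv_cong_open[OF chart(1) that 1])
    then show ?thesis
      using dderiv_eqI[OF has_derivative_inner[OF d d]]
      by (simp add: fun_eq_iff inner_commute)
  qed
  show "\<phi> u \<bullet> \<phi> u = 1" "\<phi> u \<bullet> dderiv \<phi> u a = 0"
    using 1 2 assms(2) by auto
  have "dderiv (\<lambda>v. \<phi> v \<bullet> dderiv \<phi> v b) u = dderiv (\<lambda>_. 0) u"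
    by (rule dderiv_cong_open[OF chart(1) assms(2) 2])
  then show "\<phi> u \<bullet> dderiv2 \<phi> u a b = - (dderiv \<phi> u a \<bullet> dderiv \<phi> u b)"
    using dderiv_eqI[OF has_derivative_inner[OF smooth_on_has_derivative[OF chart(2) assms(2)]
          smooth_on_has_derivative2[OF chart(2) assms(2)]]]
    by (simp add: fun_eq_iff add_eq_0_iff)
qed

text \<open>One inclusion is orthogonality; equality follows because an injective image of
  \<open>'e\<close> and a hyperplane of \<open>'a\<close> have the same dimension.\<close>

lemma range_dderiv_sphere_chart:
  fixes \<phi> :: "'e::euclidean_space \<Rightarrow> 'a::euclidean_space"
  assumes "DIM('a) = DIM('e) + 1" "local_parametrization U \<phi> (sphere 0 1)" "u \<in> U"
  shows "range (dderiv \<phi> u) = {v. \<phi> u \<bullet> v = 0}"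
proof (rule subspace_dim_equal)
  note chart = local_parametrizationD[OF assms(2)]
  have lin: "linear (dderiv \<phi> u)"
    by (rule smooth_on_linear_dderiv[OF chart(2) assms(3)])
  show "subspace (range (dderiv \<phi> u))"
    by (rule linear_subspace_image[OF lin subspace_UNIV])
  show "subspace {v. \<phi> u \<bullet> v = 0}"
    by (rule subspace_hyperplane)
  show "range (dderiv \<phi> u) \<subseteq> {v. \<phi> u \<bullet> v = 0}"
    using sphere_chart_identities(2)[OF assms(2,3)] by auto
  have "dim (range (dderiv \<phi> u)) = DIM('e)"
    using dim_image_eq[OF lin, of UNIV] chart(4)[OF assms(3)] by simp
  moreover have "\<phi> u \<noteq> 0"
    using sphere_chart_identities(1)[OF assms(2,3)] by auto
  ultimately show "dim {v. \<phi> u \<bullet> v = 0} \<le> dim (range (dderiv \<phi> u))"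
    using dim_hyperplane[of "\<phi> u"] assms(1) by simp
qed

text \<open>Central projection from the tangent hyperplane at \<open>x\<close> onto the open hemisphere around \<open>x\<close>.\<close>

lemma sphere_chart:
  fixes x :: "'a::euclidean_space"
  assumes "DIM('a) = DIM('e::euclidean_space) + 1" "x \<in> sphere 0 1"
  obtains \<phi> :: "'e::euclidean_space \<Rightarrow> 'a" and W \<theta> where "smooth_on UNIV \<phi>" "open W" "smooth_on W \<theta>"
    "range \<phi> = sphere 0 1 \<inter> W" "\<And>u. \<theta> (\<phi> u) = u" "x \<in> W"
proof -
  define T where "T = {y. x \<bullet> y = 0}"
  have xx: "x \<bullet> x = 1"
    using assms(2) by (simp add: dot_square_norm)
  then have "x \<noteq> 0"
    by auto
  then have dT: "dim (UNIV :: 'e set) = dim T"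
    using dim_hyperplane[of x] assms(1) by (simp add: T_def)
  have sT: "subspace T"
    unfolding T_def by (rule subspace_hyperplane)
  obtain L :: "'e \<Rightarrow> 'a" and g where L: "linear L" "linear g" "range L = T"
    "\<And>u. g (L u) = u" "\<And>y. y \<in> T \<Longrightarrow> L (g y) = y"
    by (rule isometries_subspaces[OF subspace_UNIV sT dT]) (rule that; simp)
  then have bL: "bounded_linear L" "bounded_linear g"
    by (simp_all add: linear_conv_bounded_linear)
  define N where "N u = (x + L u) \<bullet> (x + L u)" for u
  define \<phi> where "\<phi> u = N u powr (- 1 / 2) *\<^sub>R (x + L u)" for u
  define W where "W = {y. 0 < x \<bullet> y}"
  \<comment> \<open>Rescaling by the reciprocal of \<open>x \<bullet> y\<close> moves
    \<open>y\<close> along its ray to the affine hyperplane through \<open>x\<close>, from which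
    \<open>g\<close> reads off the parameter.\<close>
  define \<theta> where "\<theta> y = g ((x \<bullet> y) powr (- 1) *\<^sub>R y - x)" for y
  have xL: "x \<bullet> L u = 0" for u
    using L(3) by (auto simp: T_def)
  then have "N u = 1 + L u \<bullet> L u" for u
    by (simp add: N_def inner_add xx inner_commute)
  then have N: "0 < N u" for u
    by (simp add: add_pos_nonneg)
  have sq: "r powr (- 1 / 2) * r powr (- 1 / 2) * r = 1" if "0 < r" for r :: real
  proof -
    have "r powr (- 1 / 2) * r powr (- 1 / 2) * r = r powr (- 1 / 2 + (- 1 / 2) + 1)"
      using that by (simp only: powr_add) simp
    also have "- 1 / 2 + (- 1 / 2) + 1 = (0::real)"
      by simp
    finally show ?thesis
      using that by simp
  qed
  have smL: "smooth_on UNIV (\<lambda>u. x + L u)"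
    by (intro smooth_on_add smooth_on_const smooth_on_bounded_linear bL open_UNIV)
  have openW: "open W"
    unfolding W_def by (intro open_Collect_less continuous_intros)
  show ?thesis
  proof
    show "smooth_on UNIV \<phi>"
      unfolding \<phi>_def using N
      by (intro smooth_on_scaleR open_UNIV smL smooth_on_powr_compose)
        (auto simp: N_def[abs_def] intro!: smooth_on_inner smL)
    show "open W"
      by (fact openW)
    have "smooth_on W (\<lambda>y. (x \<bullet> y) powr (- 1) *\<^sub>R y - x)"
      by (intro smooth_on_diff smooth_on_scaleR smooth_on_powr_compose smooth_on_const openW
          smooth_on_bounded_linear bounded_linear_ident bounded_linear_inner_right)
        (simp add: W_def)
    then show "smooth_on W \<theta>"
      unfolding \<theta>_def by (rule smooth_on_bounded_linear_compose[OF bL(2) openW])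
    show "x \<in> W"
      by (simp add: W_def xx)
    have x\<phi>: "x \<bullet> \<phi> u = N u powr (- 1 / 2)" for u
      by (simp add: \<phi>_def inner_add xx xL)
    show "\<theta> (\<phi> u) = u" for u
    proof -
      have "(x \<bullet> \<phi> u) powr (- 1) * N u powr (- 1 / 2) = 1"
        using N[of u] by (simp add: x\<phi> powr_powr flip: powr_add)
      then have "(x \<bullet> \<phi> u) powr (- 1) *\<^sub>R \<phi> u = x + L u"
        by (simp add: \<phi>_def)
      then show ?thesis
        by (simp add: \<theta>_def L(4))
    qed
    show "range \<phi> = sphere 0 1 \<inter> W"
    proof (intro equalityI subsetI IntI)
      fix y
      assume "y \<in> range \<phi>"
      then obtain u where y: "y = \<phi> u"
        by blast
      show "y \<in> W"
        using N[of u] by (simp add: W_def y x\<phi>)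
      have "y \<bullet> y = 1"
        using sq[OF N[of u]] by (simp add: y \<phi>_def N_def[symmetric])
      then show "y \<in> sphere 0 1"
        by (simp add: norm_eq_1)
    next
      fix y
      assume y: "y \<in> sphere 0 1 \<inter> W"
      define s where "s = inverse (x \<bullet> y)"
      have "0 < x \<bullet> y" and yy: "y \<bullet> y = 1"
        using y by (simp_all add: W_def dot_square_norm)
      then have s: "0 < s" "s * (x \<bullet> y) = 1"
        by (simp_all add: s_def)
      then have "L (g (s *\<^sub>R y - x)) = s *\<^sub>R y - x"
        by (intro L(5)) (simp add: T_def inner_diff xx)
      \<comment> \<open>Here \<open>x + L u\<close> is \<open>s *\<^sub>R y\<close> with
        \<open>y\<close> a unit vector, so \<open>N\<close> takes the value
        \<open>s * s\<close>.\<close>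
      then have "\<phi> (g (s *\<^sub>R y - x)) = (s * s) powr (- 1 / 2) *\<^sub>R s *\<^sub>R y"
        by (simp add: \<phi>_def N_def yy)
      also have "(s * s) powr (- 1 / 2) = inverse s"
        using s(1) by (simp add: powr_minus powr_half_sqrt)
      finally have "\<phi> (g (s *\<^sub>R y - x)) = y"
        using s(1) by simp
      then show "y \<in> range \<phi>"
        by (metis rangeI)
    qed
  qed
qed

text \<open>A curve on the sphere has velocity orthogonal to its position. Conversely, a vector
  orthogonal to \<open>x\<close> is \<open>dderiv \<phi> u a\<close> for a chart, and the image of
  the line \<open>u + t *\<^sub>R a\<close> is a curve with that velocity.\<close>

lemma tangent_space_sphere:
  fixes x :: "'a::euclidean_space"
  assumes "DIM('a) = DIM('e::euclidean_space) + 1" "x \<in> sphere 0 1"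
  shows "tangent_space (sphere 0 1) x = {v. x \<bullet> v = 0}"
proof (intro equalityI subsetI)
  fix v
  assume "v \<in> tangent_space (sphere 0 1) x"
  then obtain \<epsilon> \<gamma> where \<gamma>: "\<epsilon> > 0" "\<gamma> ` {-\<epsilon><..<\<epsilon>} \<subseteq> sphere 0 1" "\<gamma> 0 = x"
    "(\<gamma> has_vector_derivative v) (at (0::real))"
    unfolding tangent_space_def by blast
  then have d: "(\<gamma> has_derivative (\<lambda>t. t *\<^sub>R v)) (at 0)"
    by (simp add: has_vector_derivative_def)
  have "dderiv (\<lambda>t. \<gamma> t \<bullet> \<gamma> t) 0 = dderiv (\<lambda>_. 1) 0"
    using \<gamma>(1,2) by (intro dderiv_cong_open[of "{-\<epsilon><..<\<epsilon>}"]) (auto simp: dot_square_norm image_subset_iff)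
  then have "dderiv (\<lambda>t. \<gamma> t \<bullet> \<gamma> t) 0 1 = 0"
    by simp
  then show "v \<in> {v. x \<bullet> v = 0}"
    using dderiv_eqI[OF has_derivative_inner[OF d d]] \<gamma>(3) by (simp add: inner_commute)
next
  fix v
  assume "v \<in> {v. x \<bullet> v = 0}"
  obtain \<phi> :: "'e \<Rightarrow> 'a" and W \<theta> where c: "smooth_on UNIV \<phi>" "open W" "smooth_on W \<theta>"
    "range \<phi> = sphere 0 1 \<inter> W" "\<And>u. \<theta> (\<phi> u) = u" "x \<in> W"
    by (rule sphere_chart[OF assms]) (rule that)
  have lp: "local_parametrization UNIV \<phi> (sphere 0 1)"
    by (rule local_parametrizationI[OF open_UNIV c(1-5)])
  obtain u where u: "x = \<phi> u"
    using c(4,6) assms(2) by blast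
  obtain a where a: "v = dderiv \<phi> u a"
    using range_dderiv_sphere_chart[OF assms(1) lp, of u] \<open>v \<in> _\<close> u by blast
  have line: "((\<lambda>t. u + t *\<^sub>R a) has_derivative (\<lambda>t. t *\<^sub>R a)) (at 0)"
    by (auto intro!: derivative_eq_intros)
  have "(\<phi> has_derivative dderiv \<phi> u) (at (u + 0 *\<^sub>R a))"
    using smooth_on_has_derivative[OF c(1) UNIV_I] by simp
  from has_derivative_compose[OF line this]
  have "((\<lambda>t. \<phi> (u + t *\<^sub>R a)) has_vector_derivative v) (at 0)"
    using linear_cmul[OF smooth_on_linear_dderiv[OF c(1) UNIV_I]]
    by (simp add: has_vector_derivative_def a)
  moreover have "smooth_on {- 1<..<1::real} (\<lambda>t. \<phi> (u + t *\<^sub>R a))"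
    by (intro smooth_on_compose[OF c(1) open_UNIV] smooth_on_add smooth_on_const
        smooth_on_bounded_linear[OF bounded_linear_scaleR_left]) auto
  moreover have "\<phi> y \<in> sphere 0 1" for y
    using c(4) by blast
  ultimately show "v \<in> tangent_space (sphere 0 1) x"
    unfolding tangent_space_def
    by (intro CollectI exI[of _ 1] exI[of _ "\<lambda>t. \<phi> (u + t *\<^sub>R a)"]) (auto simp: u)
qed

section \<open>The tangent bundle of the sphere as a submanifold of the doubled space\<close>

lemma tangent_bundle_sphere:
  assumes "DIM('a::euclidean_space) = DIM('e::euclidean_space) + 1"
  shows "tangent_bundle (sphere 0 1) = {(x :: 'a, v). x \<in> sphere 0 1 \<and> x \<bullet> v = 0}"
  unfolding tangent_bundle_def using tangent_space_sphere[OF assms] by auto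

lemma submanifold_sphere:
  assumes "DIM('a::euclidean_space) = DIM('e::euclidean_space) + 1"
  shows "submanifold TYPE('e) (sphere 0 1 :: 'a set)"
  unfolding submanifold_def
proof
  fix x :: 'a
  assume x: "x \<in> sphere 0 1"
  obtain \<phi> :: "'e \<Rightarrow> 'a" and W \<theta> where c: "smooth_on UNIV \<phi>" "open W" "smooth_on W \<theta>"
    "range \<phi> = sphere 0 1 \<inter> W" "\<And>u. \<theta> (\<phi> u) = u" "x \<in> W"
    by (rule sphere_chart[OF assms x]) (rule that)
  show "\<exists>(U::'e set) \<phi>. local_parametrization U \<phi> (sphere 0 1) \<and> x \<in> \<phi> ` U"
    using local_parametrizationI[OF open_UNIV c(1-5)] c(4,6) x by blast
qed

text \<open>The chart is \<open>tangent_map \<phi>\<close>, with ambient inverse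
  \<open>tangent_map \<theta>\<close>; that these are inverse is the identity
  \<open>\<theta> (\<phi> u) = u\<close> together with its derivative.\<close>

lemma submanifold_tangent_bundle_sphere:
  assumes "DIM('a::euclidean_space) = DIM('e::euclidean_space) + 1"
  shows "submanifold TYPE('e \<times> 'e) (tangent_bundle (sphere 0 1 :: 'a set))"
  unfolding submanifold_def
proof
  fix e :: "'a \<times> 'a"
  assume e: "e \<in> tangent_bundle (sphere 0 1)"
  then have "fst e \<in> sphere 0 1"
    by (auto simp: tangent_bundle_def)
  obtain \<phi> :: "'e \<Rightarrow> 'a" and W \<theta> where c: "smooth_on UNIV \<phi>" "open W" "smooth_on W \<theta>"
    "range \<phi> = sphere 0 1 \<inter> W" "\<And>u. \<theta> (\<phi> u) = u" "fst e \<in> W"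
    by (rule sphere_chart[OF assms \<open>fst e \<in> _\<close>]) (rule that)
  have lp: "local_parametrization UNIV \<phi> (sphere 0 1)"
    by (rule local_parametrizationI[OF open_UNIV c(1-5)])
  have chain: "dderiv \<theta> (\<phi> u) (dderiv \<phi> u a) = a" for u a
  proof -
    have "\<phi> u \<in> W"
      using c(4) by blast
    from has_derivative_compose[OF smooth_on_has_derivative[OF c(1) UNIV_I]
        smooth_on_has_derivative[OF c(3) this]]
    have "((\<lambda>u. u) has_derivative (\<lambda>a. dderiv \<theta> (\<phi> u) (dderiv \<phi> u a))) (at u)"
      by (simp add: c(5))
    from fun_cong[OF has_derivative_unique[OF this has_derivative_ident]] show ?thesis .
  qed
  have img: "tangent_map \<phi> ` UNIV = tangent_bundle (sphere 0 1) \<inter> W \<times> UNIV"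
  proof (intro equalityI subsetI)
    fix z
    assume "z \<in> tangent_map \<phi> ` UNIV"
    then obtain u a where "z = (\<phi> u, dderiv \<phi> u a)"
      by (auto simp: tangent_map_def)
    moreover have "\<phi> u \<in> sphere 0 1 \<inter> W"
      using c(4) by blast
    ultimately show "z \<in> tangent_bundle (sphere 0 1) \<inter> W \<times> UNIV"
      using sphere_chart_identities(2)[OF lp, of u a]
      by (simp add: tangent_bundle_sphere[OF assms])
  next
    fix z
    assume z: "z \<in> tangent_bundle (sphere 0 1 :: 'a set) \<inter> W \<times> UNIV"
    then have "fst z \<in> sphere 0 1 \<inter> W" "fst z \<bullet> snd z = 0"
      by (auto simp: tangent_bundle_sphere[OF assms])
    then obtain u where u: "fst z = \<phi> u"
      using c(4) by blast
    then obtain a where a: "snd z = dderiv \<phi> u a"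
      using range_dderiv_sphere_chart[OF assms lp, of u] \<open>fst z \<bullet> snd z = 0\<close> by auto
    have "z = tangent_map \<phi> (u, a)"
      by (simp add: tangent_map_def prod_eq_iff u a)
    then show "z \<in> tangent_map \<phi> ` UNIV"
      by blast
  qed
  have smooth: "smooth_on UNIV (tangent_map \<phi>)"
    using smooth_on_tangent_map[OF open_UNIV c(1)] by simp
  have "local_parametrization UNIV (tangent_map \<phi>) (tangent_bundle (sphere 0 1))"
    by (rule local_parametrizationI[OF open_UNIV smooth open_Times[OF c(2) open_UNIV]
          smooth_on_tangent_map[OF c(2,3)] img])
      (auto simp: tangent_map_def c(5) chain)
  moreover have "e \<in> tangent_map \<phi> ` UNIV"
    unfolding img using e c(6) by (auto simp: mem_Times_iff)
  ultimately show "\<exists>(U::('e \<times> 'e) set) \<psi>.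
      local_parametrization U \<psi> (tangent_bundle (sphere 0 1)) \<and> e \<in> \<psi> ` U"
    by blast
qed

text \<open>The equations \<open>x \<bullet> x = 1\<close> and \<open>x \<bullet> v = 0\<close> cut
  out the bundle; differentiating them gives the two tangency conditions.\<close>

lemma tangent_bundle_sphere_chart_identities:
  fixes \<psi> :: "'e::euclidean_space \<times> 'e \<Rightarrow> 'a::euclidean_space \<times> 'a"
  assumes "DIM('a) = DIM('e) + 1"
    and "local_parametrization V \<psi> (tangent_bundle (sphere 0 1))" "w \<in> V"
  shows "fst (\<psi> w) \<bullet> fst (\<psi> w) = 1" "fst (\<psi> w) \<bullet> snd (\<psi> w) = 0"
    "fst (\<psi> w) \<bullet> fst (dderiv \<psi> w c) = 0"
    "fst (\<psi> w) \<bullet> snd (dderiv \<psi> w c) = - (fst (dderiv \<psi> w c) \<bullet> snd (\<psi> w))"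
proof -
  note chart = local_parametrizationD[OF assms(2)]
  have 1: "fst (\<psi> w) \<bullet> fst (\<psi> w) = 1" and 2: "fst (\<psi> w) \<bullet> snd (\<psi> w) = 0" if "w \<in> V" for w
    using chart(5)[OF that] by (auto simp: tangent_bundle_sphere[OF assms(1)] dot_square_norm)
  show "fst (\<psi> w) \<bullet> fst (\<psi> w) = 1" "fst (\<psi> w) \<bullet> snd (\<psi> w) = 0"
    using 1 2 assms(3) by auto
  note d = smooth_on_has_derivative[OF chart(2) assms(3)]
  have "dderiv (\<lambda>w. fst (\<psi> w) \<bullet> fst (\<psi> w)) w = dderiv (\<lambda>_. 1) w"
    by (rule dderiv_cong_open[OF chart(1) assms(3) 1])
  then show "fst (\<psi> w) \<bullet> fst (dderiv \<psi> w c) = 0"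
    using dderiv_eqI[OF has_derivative_inner[OF has_derivative_fst[OF d] has_derivative_fst[OF d]]]
    by (cases c) (simp add: fun_eq_iff inner_commute)
  have "dderiv (\<lambda>w. fst (\<psi> w) \<bullet> snd (\<psi> w)) w = dderiv (\<lambda>_. 0) w"
    by (rule dderiv_cong_open[OF chart(1) assms(3) 2])
  then show "fst (\<psi> w) \<bullet> snd (dderiv \<psi> w c) = - (fst (dderiv \<psi> w c) \<bullet> snd (\<psi> w))"
    using dderiv_eqI[OF has_derivative_inner[OF has_derivative_fst[OF d] has_derivative_snd[OF d]]]
    by (cases c) (simp add: fun_eq_iff add_eq_0_iff)
qed

section \<open>Levi-Civita connection and connection map of the round sphere\<close>

lemma ambient_chart_round:
  assumes "local_parametrization U \<phi> M"
  shows "ambient_chart round_metric U \<phi> (pullback_metric round_metric \<phi>)"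
proof
  note chart = local_parametrizationD[OF assms]
  show "open U" "smooth_on U \<phi>" "\<And>u. u \<in> U \<Longrightarrow> inj (dderiv \<phi> u)"
    by (fact chart)+
  show "0 < round_metric (\<phi> u) (dderiv \<phi> u a) (dderiv \<phi> u a)" if "u \<in> U" "a \<noteq> 0" for u a
    using chart(4)[OF that(1)] that(2) smooth_on_linear_dderiv[OF chart(2) that(1)]
    by (auto simp: round_metric_def linear_injective_0)
qed (simp add: pullback_metric_def)

text \<open>This is the Gauss formula: the connection is the tangential part of the flat second
  derivative. The difference \<open>D\<close> of the two sides is orthogonal to
  \<open>\<phi> u\<close>, hence tangent, and \<open>christoffel_G\<close> makes it orthogonal to
  tangent vectors, hence to itself.\<close>

lemma dderiv_christoffel_sphere:
  fixes \<phi> :: "'e::euclidean_space \<Rightarrow> 'a::euclidean_space"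
  assumes "DIM('a) = DIM('e) + 1" "local_parametrization U \<phi> (sphere 0 1)" "u \<in> U"
  shows "dderiv \<phi> u (christoffel (pullback_metric round_metric \<phi>) u a b) =
    dderiv2 \<phi> u a b + (dderiv \<phi> u a \<bullet> dderiv \<phi> u b) *\<^sub>R \<phi> u"
proof -
  define D where "D = dderiv \<phi> u (christoffel (pullback_metric round_metric \<phi>) u a b)
    - (dderiv2 \<phi> u a b + (dderiv \<phi> u a \<bullet> dderiv \<phi> u b) *\<^sub>R \<phi> u)"
  note id = sphere_chart_identities[OF assms(2,3)]
  have "\<phi> u \<bullet> D = 0"
    by (simp add: D_def inner_diff inner_add id)
  then obtain c where c: "D = dderiv \<phi> u c"
    using range_dderiv_sphere_chart[OF assms] by blast
  have "D \<bullet> dderiv \<phi> u c = 0"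
    using ambient_chart.christoffel_G[OF ambient_chart_round[OF assms(2)] assms(3), of a b c] id(2)[of c]
    by (simp add: D_def DH_round round_metric_def inner_diff inner_add)
  then have "D = 0"
    by (simp flip: c)
  then show ?thesis
    by (simp add: D_def)
qed

text \<open>By the Gauss formula the second derivatives of the chart cancel in \<open>K\<close>,
  leaving a value that depends on the point and the vector alone. This gives uniqueness over all
  charts, and a central projection chart gives existence.\<close>

lemma connection_map_sphere:
  fixes x v :: "'a::euclidean_space"
  assumes "DIM('a) = DIM('e::euclidean_space) + 1" "x \<in> sphere 0 1" "x \<bullet> v = 0"
    "x \<bullet> A1 = 0" "x \<bullet> A2 = - (A1 \<bullet> v)"
  shows "connection_map TYPE('e) (sphere 0 1) round_metric (x, v) (A1, A2) = A2 + (A1 \<bullet> v) *\<^sub>R x"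
  unfolding connection_map_def
proof (rule the_equality)
  obtain \<phi> :: "'e \<Rightarrow> 'a" and W \<theta> where c: "smooth_on UNIV \<phi>" "open W" "smooth_on W \<theta>"
    "range \<phi> = sphere 0 1 \<inter> W" "\<And>u. \<theta> (\<phi> u) = u" "x \<in> W"
    by (rule sphere_chart[OF assms(1,2)]) (rule that)
  have lp: "local_parametrization UNIV \<phi> (sphere 0 1)"
    by (rule local_parametrizationI[OF open_UNIV c(1-5)])
  obtain u where u: "x = \<phi> u"
    using c(4,6) assms(2) by blast
  note rng = range_dderiv_sphere_chart[OF assms(1) lp UNIV_I, of u]
  note lin = smooth_on_linear_dderiv[OF c(1) UNIV_I, of u]
  obtain \<epsilon> a where ea: "v = dderiv \<phi> u \<epsilon>" "A1 = dderiv \<phi> u a"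
    using rng assms(3,4) u by blast
  \<comment> \<open>Tangency of \<open>(A1, A2)\<close> says precisely that \<open>A2\<close> has
    the same normal component as the second derivative, so the remainder is tangent.\<close>
  have "\<phi> u \<bullet> (A2 - dderiv2 \<phi> u a \<epsilon>) = 0"
    using assms(5) sphere_chart_identities(3)[OF lp UNIV_I, of u a \<epsilon>]
    by (simp add: inner_diff u ea)
  then obtain b where "A2 - dderiv2 \<phi> u a \<epsilon> = dderiv \<phi> u b"
    using rng by blast
  then have b: "A2 = dderiv2 \<phi> u a \<epsilon> + dderiv \<phi> u b"
    by (simp add: algebra_simps)
  show "\<exists>(U::'e set) \<phi> u \<epsilon> a b. local_parametrization U \<phi> (sphere 0 1) \<and> u \<in> U \<and>
      (x, v) = tangent_map \<phi> (u, \<epsilon>) \<and> (A1, A2) = dderiv (tangent_map \<phi>) (u, \<epsilon>) (a, b) \<and>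
      A2 + (A1 \<bullet> v) *\<^sub>R x = dderiv \<phi> u (b + christoffel (pullback_metric round_metric \<phi>) u a \<epsilon>)"
  proof (intro exI conjI)
    show "A2 + (A1 \<bullet> v) *\<^sub>R x = dderiv \<phi> u (b + christoffel (pullback_metric round_metric \<phi>) u a \<epsilon>)"
      by (simp add: linear_add[OF lin] dderiv_christoffel_sphere[OF assms(1) lp] u ea b)
  qed (use lp in \<open>auto simp: tangent_map_def u ea b dderiv_tangent_map[OF open_UNIV c(1), unfolded tangent_map_def]\<close>)
next
  fix k
  assume "\<exists>(U::'e set) \<phi> u \<epsilon> a b. local_parametrization U \<phi> (sphere 0 1) \<and> u \<in> U \<and>
      (x, v) = tangent_map \<phi> (u, \<epsilon>) \<and> (A1, A2) = dderiv (tangent_map \<phi>) (u, \<epsilon>) (a, b) \<and>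
      k = dderiv \<phi> u (b + christoffel (pullback_metric round_metric \<phi>) u a \<epsilon>)"
  then obtain U :: "'e set" and \<phi> u \<epsilon> a b where lp: "local_parametrization U \<phi> (sphere 0 1)" "u \<in> U"
    and e: "(x, v) = tangent_map \<phi> (u, \<epsilon>)" and A: "(A1, A2) = dderiv (tangent_map \<phi>) (u, \<epsilon>) (a, b)"
    and k: "k = dderiv \<phi> u (b + christoffel (pullback_metric round_metric \<phi>) u a \<epsilon>)"
    by blast
  note chart = local_parametrizationD[OF lp(1)]
  have "x = \<phi> u" "v = dderiv \<phi> u \<epsilon>"
    using e by (simp_all add: tangent_map_def)
  moreover have "A1 = dderiv \<phi> u a" "A2 = dderiv2 \<phi> u a \<epsilon> + dderiv \<phi> u b"
    using A by (simp_all add: dderiv_tangent_map[OF chart(1,2) lp(2)])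
  ultimately show "k = A2 + (A1 \<bullet> v) *\<^sub>R x"
    by (simp add: k linear_add[OF smooth_on_linear_dderiv[OF chart(2) lp(2)]]
        dderiv_christoffel_sphere[OF assms(1) lp])
qed

section \<open>The generalised Cheeger-Gromoll metric of the sphere\<close>

text \<open>At \<open>(x, v)\<close> the connection map of the sphere is \<open>A \<mapsto> snd A + (fst A \<bullet> v) x\<close>, and tangency of \<open>A\<close>
  means \<open>x \<bullet> fst A = 0\<close> and \<open>x \<bullet> snd A = - (fst A \<bullet> v)\<close>.  Hence \<open>KA \<bullet> KB\<close> equals
  \<open>snd A \<bullet> snd B - (fst A \<bullet> v) (fst B \<bullet> v)\<close>, an expression that is independent of \<open>x\<close>.\<close>

definition sphere_cg :: "real \<Rightarrow> real \<Rightarrow> ('a::euclidean_space \<times> 'a) metric_field"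
  where
    "sphere_cg p q y A B = fst A \<bullet> fst B + (1 + snd y \<bullet> snd y) powr (- p) *
       (snd A \<bullet> snd B - (fst A \<bullet> snd y) * (fst B \<bullet> snd y) + q * (snd A \<bullet> snd y) * (snd B \<bullet> snd y))"

lemma one_plus_inner_pos: "0 < 1 + x \<bullet> x"
  by (simp add: add_pos_nonneg)

interpretation cg: ambient_metric "sphere_cg p q" for p q
proof
  show "bilinear (sphere_cg p q y)" for y :: "'a \<times> 'a"
    unfolding bilinear_def
    by (auto intro!: linearI simp: sphere_cg_def inner_add algebra_simps)
  show "sphere_cg p q y A B = sphere_cg p q y B A" for y A B :: "'a \<times> 'a"
    by (simp add: sphere_cg_def inner_commute mult.commute mult.left_commute)
  show "smooth_on UNIV (\<lambda>z::('a \<times> 'a) \<times> ('a \<times> 'a) \<times> ('a \<times> 'a).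
      sphere_cg p q (fst z) (fst (snd z)) (snd (snd z)))"
    unfolding sphere_cg_def
    by (intro smooth_on_add smooth_on_diff smooth_on_mult smooth_on_inner smooth_on_powr_compose
        smooth_on_const smooth_on_fst smooth_on_snd smooth_on_bounded_linear[OF bounded_linear_ident]
        open_UNIV one_plus_inner_pos)
qed

lemma DH_sphere_cg:
  "cg.DH p q y C A B =
    - 2 * p * (1 + snd y \<bullet> snd y) powr (- p - 1) * (snd y \<bullet> snd C) *
      (snd A \<bullet> snd B - (fst A \<bullet> snd y) * (fst B \<bullet> snd y) + q * (snd A \<bullet> snd y) * (snd B \<bullet> snd y))
    + (1 + snd y \<bullet> snd y) powr (- p) *
      (q * (snd A \<bullet> snd C) * (snd B \<bullet> snd y) + q * (snd A \<bullet> snd y) * (snd B \<bullet> snd C)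
       - (fst A \<bullet> snd C) * (fst B \<bullet> snd y) - (fst A \<bullet> snd y) * (fst B \<bullet> snd C))"
proof -
  have snd: "(snd has_derivative snd) (at y)"
    by (rule bounded_linear_imp_has_derivative[OF bounded_linear_snd])
  have i: "((\<lambda>y. X \<bullet> snd y) has_derivative (\<lambda>C. X \<bullet> snd C)) (at y)" for X
    by (rule has_derivative_inner_right[OF snd])
  have "((\<lambda>y. 1 + snd y \<bullet> snd y) has_derivative (\<lambda>C. 2 * (snd y \<bullet> snd C))) (at y)"
    using has_derivative_add[OF has_derivative_const has_derivative_inner[OF snd snd], of 1]
    by (simp add: inner_commute)
  from has_derivative_powr[OF this has_derivative_const one_plus_inner_pos, of "- p"]
  have w: "((\<lambda>y. (1 + snd y \<bullet> snd y) powr (- p)) has_derivative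
      (\<lambda>C. - 2 * p * (1 + snd y \<bullet> snd y) powr (- p - 1) * (snd y \<bullet> snd C))) (at y)"
    using one_plus_inner_pos[of "snd y"] by (simp add: powr_diff mult_ac)
  show ?thesis
    unfolding cg.DH_def sphere_cg_def
    by (subst dderiv_eqI[OF has_derivative_add[OF has_derivative_const has_derivative_mult[OF w
        has_derivative_add[OF has_derivative_diff[OF has_derivative_const has_derivative_mult[OF i i]]
         has_derivative_mult[OF has_derivative_mult_right[OF i] i]]]]])
      (simp add: algebra_simps)
qed

lemma cheeger_gromoll_sphere:
  fixes x v :: "'a::euclidean_space"
  assumes "DIM('a) = DIM('e::euclidean_space) + 1" "x \<in> sphere 0 1" "x \<bullet> v = 0"
    and A: "x \<bullet> A1 = 0" "x \<bullet> A2 = - (A1 \<bullet> v)" and B: "x \<bullet> B1 = 0" "x \<bullet> B2 = - (B1 \<bullet> v)"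
  shows "cheeger_gromoll TYPE('e) (sphere 0 1) round_metric p q (x, v) (A1, A2) (B1, B2) =
    sphere_cg p q (x, v) (A1, A2) (B1, B2)"
proof -
  have xx: "x \<bullet> x = 1"
    using assms(2) by (simp add: dot_square_norm)
  have w: "(1 / (1 + v \<bullet> v)) powr p = (1 + v \<bullet> v) powr (- p)"
    using one_plus_inner_pos[of v] by (simp add: powr_divide powr_minus_divide)
  \<comment> \<open>Each of the two cross terms contributes
    \<open>- (A1 \<bullet> v) * (B1 \<bullet> v)\<close>, and the term with
    \<open>x \<bullet> x = 1\<close> gives one of them back.\<close>
  have K: "(A2 + (A1 \<bullet> v) *\<^sub>R x) \<bullet> (B2 + (B1 \<bullet> v) *\<^sub>R x) = A2 \<bullet> B2 - (A1 \<bullet> v) * (B1 \<bullet> v)"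
    using A B inner_commute[of A2 x] by (simp add: inner_add_left inner_add_right xx)
  have KA: "(A2 + (A1 \<bullet> v) *\<^sub>R x) \<bullet> v = A2 \<bullet> v" "(B2 + (B1 \<bullet> v) *\<^sub>R x) \<bullet> v = B2 \<bullet> v"
    by (simp_all add: inner_add_left assms(3))
  show ?thesis
    unfolding cheeger_gromoll_def Let_def fst_conv snd_conv
      connection_map_sphere[OF assms(1-3) A] connection_map_sphere[OF assms(1-3) B]
      round_metric_def sphere_cg_def K KA w
    by simp
qed

text \<open>Positivity rests on tangency: \<open>A1 \<bullet> v\<close> is minus the inner product
  of \<open>A2\<close> with a unit vector, so Cauchy-Schwarz bounds the negative square by
  \<open>A2 \<bullet> A2\<close>. If \<open>A1\<close> vanishes, so does that square, and
  \<open>A2\<close> must be nonzero.\<close>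

lemma ambient_chart_tangent_bundle_sphere:
  fixes \<psi> :: "'e::euclidean_space \<times> 'e \<Rightarrow> 'a::euclidean_space \<times> 'a"
  assumes dim: "DIM('a) = DIM('e) + 1" and "q \<ge> 0"
    and lp: "local_parametrization V \<psi> (tangent_bundle (sphere 0 1))"
  shows "ambient_chart (sphere_cg p q) V \<psi>
    (pullback_metric (cheeger_gromoll TYPE('e) (sphere 0 1) round_metric p q) \<psi>)"
proof
  note chart = local_parametrizationD[OF lp]
  show "open V" "smooth_on V \<psi>" "\<And>w. w \<in> V \<Longrightarrow> inj (dderiv \<psi> w)"
    by (fact chart)+
  show "0 < sphere_cg p q (\<psi> w) (dderiv \<psi> w a) (dderiv \<psi> w a)" if "w \<in> V" "a \<noteq> 0" for w a
  proof -
    note id = tangent_bundle_sphere_chart_identities[OF dim lp \<open>w \<in> V\<close>]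
    define v A1 A2 W where "v = snd (\<psi> w)" and "A1 = fst (dderiv \<psi> w a)"
      and "A2 = snd (dderiv \<psi> w a)" and "W = (1 + v \<bullet> v) powr (- p)"
    have "(A1 \<bullet> v)\<^sup>2 \<le> A2 \<bullet> A2"
      using Cauchy_Schwarz_ineq[of "fst (\<psi> w)" A2] id(4)[of a]
      by (simp add: A1_def A2_def v_def id(1))
    moreover have "W > 0"
      using one_plus_inner_pos[of v] by (simp add: W_def)
    moreover have "0 \<le> q * (A2 \<bullet> v)\<^sup>2"
      using \<open>q \<ge> 0\<close> by simp
    ultimately have nonneg: "0 \<le> W * (A2 \<bullet> A2 - (A1 \<bullet> v)\<^sup>2 + q * (A2 \<bullet> v)\<^sup>2)"
      by simp
    have "dderiv \<psi> w a \<noteq> 0"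
      using chart(4)[OF that(1)] that(2) linear_injective_0[OF smooth_on_linear_dderiv[OF chart(2) that(1)]]
      by blast
    then have "A1 \<noteq> 0 \<or> A2 \<noteq> 0"
      by (simp add: A1_def A2_def prod_eq_iff)
    then have "0 < A1 \<bullet> A1 + W * (A2 \<bullet> A2 - (A1 \<bullet> v)\<^sup>2 + q * (A2 \<bullet> v)\<^sup>2)"
    proof (cases "A1 = 0")
      case True
      then have "0 < A2 \<bullet> A2"
        using \<open>A1 \<noteq> 0 \<or> A2 \<noteq> 0\<close> by simp
      then show ?thesis
        using True \<open>W > 0\<close> \<open>0 \<le> q * (A2 \<bullet> v)\<^sup>2\<close> by (simp add: add_pos_nonneg)
    next
      case False
      then show ?thesis
        using nonneg by (simp add: add_pos_nonneg)
    qed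
    then show ?thesis
      by (simp add: sphere_cg_def A1_def A2_def v_def W_def power2_eq_square mult.assoc)
  qed
  show "pullback_metric (cheeger_gromoll TYPE('e) (sphere 0 1) round_metric p q) \<psi> w a b =
      sphere_cg p q (\<psi> w) (dderiv \<psi> w a) (dderiv \<psi> w b)" if "w \<in> V" for w a b
  proof -
    note id = tangent_bundle_sphere_chart_identities[OF dim lp \<open>w \<in> V\<close>]
    have "fst (\<psi> w) \<in> sphere 0 1"
      using id(1) by (simp add: norm_eq_1)
    from cheeger_gromoll_sphere[OF dim this id(2) id(3,4)[of a] id(3,4)[of b], of p q]
    show ?thesis
      by (simp add: pullback_metric_def)
  qed
qed

section \<open>The tension field of a Hopf section\<close>

text \<open>The coordinate frame and its metric dual behave like an orthonormal frame: the sum of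
  their tensor products is the orthogonal projection onto the tangent hyperplane, whence the
  correction by the normal components.\<close>

lemma sphere_chart_trace:
  fixes \<phi> :: "'e::euclidean_space \<Rightarrow> 'a::euclidean_space"
  assumes dim: "DIM('a) = DIM('e) + 1" and lp: "local_parametrization U \<phi> (sphere 0 1)" and "u \<in> U"
  defines "dual \<equiv> \<lambda>i. THE v. \<forall>w. pullback_metric round_metric \<phi> u v w = i \<bullet> w"
  shows "(\<Sum>i\<in>Basis. (dderiv \<phi> u i \<bullet> y) * (dderiv \<phi> u (dual i) \<bullet> z)) =
      y \<bullet> z - (\<phi> u \<bullet> y) * (\<phi> u \<bullet> z)"
proof -
  interpret ambient_chart round_metric U \<phi> "pullback_metric round_metric \<phi>"
    by (rule ambient_chart_round[OF lp])
  let ?D = "dderiv \<phi> u"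
  note lin = linear_d\<psi>[OF \<open>u \<in> U\<close>]
  note id = sphere_chart_identities[OF lp \<open>u \<in> U\<close>]
  have "linear (\<lambda>w. i \<bullet> w)" for i :: 'e
    by (simp add: linear_iff inner_add)
  from theI'[OF riesz_ex1[OF bilinear_G[OF \<open>u \<in> U\<close>] G_pos[OF \<open>u \<in> U\<close>] this]]
  have dual: "?D (dual i) \<bullet> ?D w = i \<bullet> w" for i w
    unfolding dual_def G_eq[OF \<open>u \<in> U\<close>] by (simp add: round_metric_def)
  have "\<phi> u \<bullet> (y - (\<phi> u \<bullet> y) *\<^sub>R \<phi> u) = 0"
    by (simp add: inner_diff id)
  then obtain a where a: "y - (\<phi> u \<bullet> y) *\<^sub>R \<phi> u = ?D a"
    using range_dderiv_sphere_chart[OF dim lp \<open>u \<in> U\<close>] by blast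
  then have y: "y = ?D a + (\<phi> u \<bullet> y) *\<^sub>R \<phi> u"
    by (simp add: algebra_simps)
  have Dy: "?D w \<bullet> y = ?D w \<bullet> ?D a" for w
    by (subst y) (simp add: inner_add id(2) inner_commute[of _ "\<phi> u"])
  \<comment> \<open>The claim reduces to \<open>?D t\<close> being the tangential part
    \<open>?D a\<close> of \<open>y\<close>; both have the same inner product with every tangent
    vector, in particular with their difference.\<close>
  define t where "t = (\<Sum>i\<in>Basis. (?D i \<bullet> y) *\<^sub>R dual i)"
  have "?D t \<bullet> ?D w = ?D a \<bullet> ?D w" for w
  proof -
    have "?D t \<bullet> ?D w = (\<Sum>i\<in>Basis. (?D i \<bullet> ?D a) * (i \<bullet> w))"
      by (simp add: t_def linear_sum[OF lin] linear_cmul[OF lin] inner_sum_left dual Dy)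
    also have "\<dots> = (\<Sum>i\<in>Basis. (w \<bullet> i) *\<^sub>R ?D i) \<bullet> ?D a"
      by (simp add: inner_sum_left inner_commute[of w] mult.commute)
    also have "\<dots> = ?D w \<bullet> ?D a"
      by (simp flip: linear_euclidean_expand[OF lin])
    finally show ?thesis
      by (simp add: inner_commute)
  qed
  from this[of "t - a"] have "(?D t - ?D a) \<bullet> (?D t - ?D a) = 0"
    by (simp add: linear_diff[OF lin] inner_diff_left)
  then have "?D t = ?D a"
    by simp
  have "(\<Sum>i\<in>Basis. (?D i \<bullet> y) * (?D (dual i) \<bullet> z)) = ?D t \<bullet> z"
    by (simp add: t_def linear_sum[OF lin] linear_cmul[OF lin] inner_sum_left)
  also have "\<dots> = y \<bullet> z - (\<phi> u \<bullet> y) * (\<phi> u \<bullet> z)"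
    by (simp add: \<open>?D t = ?D a\<close> inner_diff flip: a)
  finally show "(\<Sum>i\<in>Basis. (?D i \<bullet> y) * (?D (dual i) \<bullet> z)) =
      y \<bullet> z - (\<phi> u \<bullet> y) * (\<phi> u \<bullet> z)" .
qed

lemma bounded_linear_graph:
  fixes J :: "'a::euclidean_space \<Rightarrow> 'b::real_normed_vector"
  assumes "linear J"
  shows "bounded_linear (\<lambda>y. (y, c *\<^sub>R J y))"
  unfolding linear_conv_bounded_linear[symmetric]
  by (rule linearI) (simp_all add: linear_add[OF assms] linear_cmul[OF assms] scaleR_add_right)

text \<open>\<open>F\<close> is the chart followed by the linear map \<open>T\<close>, so its
  derivatives are \<open>T\<close> of those of \<open>\<phi>\<close>. The hypotheses on
  \<open>(C1, C2)\<close> are tangency to the bundle at \<open>F u\<close>.\<close>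

lemma hopf_section_trace_eq_0:
  fixes \<phi> :: "'e::euclidean_space \<Rightarrow> 'a::euclidean_space" and J :: "'a \<Rightarrow> 'a"
  assumes dim: "DIM('a) = DIM('e) + 1" and lp: "local_parametrization U \<phi> (sphere 0 1)" and "u \<in> U"
    and J: "linear J" "\<And>y z. J y \<bullet> J z = y \<bullet> z" "\<And>y. y \<bullet> J y = 0"
    and c: "c\<^sup>2 * (p - 1) = 1" "p > 1"
    and C: "\<phi> u \<bullet> C1 = 0" "\<phi> u \<bullet> C2 = - (C1 \<bullet> c *\<^sub>R J (\<phi> u))"
  defines "dual \<equiv> \<lambda>i. THE v. \<forall>w. pullback_metric round_metric \<phi> u v w = i \<bullet> w"
    and "F \<equiv> \<lambda>u. (\<phi> u, c *\<^sub>R J (\<phi> u))"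
  shows "(\<Sum>i\<in>Basis.
      2 * sphere_cg p q (F u) (dderiv2 F u i (dual i)
        - dderiv F u (christoffel (pullback_metric round_metric \<phi>) u i (dual i))) (C1, C2)
      + cg.DH p q (F u) (dderiv F u i) (dderiv F u (dual i)) (C1, C2)
      + cg.DH p q (F u) (dderiv F u (dual i)) (dderiv F u i) (C1, C2)
      - cg.DH p q (F u) (C1, C2) (dderiv F u i) (dderiv F u (dual i))) = 0"
proof -
  note chart = local_parametrizationD[OF lp]
  note id = sphere_chart_identities[OF lp \<open>u \<in> U\<close>]
  define T where "T = (\<lambda>y. (y, c *\<^sub>R J y))"
  have T: "bounded_linear T"
    unfolding T_def by (rule bounded_linear_graph[OF J(1)])
  have F: "F = (\<lambda>u. T (\<phi> u))"
    by (simp add: F_def T_def)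
  have dF': "dderiv F v a = T (dderiv \<phi> v a)" if "v \<in> U" for v a
    unfolding F
    using dderiv_eqI[OF bounded_linear.has_derivative[OF T smooth_on_has_derivative[OF chart(2) that]]]
    by simp
  have dF: "dderiv F u a = T (dderiv \<phi> u a)" for a
    by (rule dF'[OF \<open>u \<in> U\<close>])
  have ddF: "dderiv2 F u a b = T (dderiv2 \<phi> u a b)" for a b
  proof -
    have "dderiv (\<lambda>v. dderiv F v b) u = dderiv (\<lambda>v. T (dderiv \<phi> v b)) u"
      by (rule dderiv_cong_open[OF chart(1) \<open>u \<in> U\<close> dF'])
    then show ?thesis
      using dderiv_eqI[OF bounded_linear.has_derivative[OF T smooth_on_has_derivative2[OF chart(2) \<open>u \<in> U\<close>]]]
      by (simp add: dderiv2_def)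
  qed
  define x v where "x = \<phi> u" and "v = c *\<^sub>R J x"
  have skew: "y \<bullet> J z = - (J y \<bullet> z)" for y z
    using J(3)[of "y + z"] J(3)[of y] J(3)[of z]
    by (simp add: linear_add[OF J(1)] inner_add inner_commute)
  have xx: "x \<bullet> x = 1"
    using id(1) by (simp add: x_def)
  have vv: "v \<bullet> v = c\<^sup>2"
    by (simp add: v_def J(2) xx power2_eq_square)
  have xv: "x \<bullet> v = 0"
    by (simp add: v_def J(3))
  define W where "W = (1 + v \<bullet> v) powr (- p)"
  have "c\<^sup>2 = 1 / (p - 1)"
    using c by (simp add: field_simps)
  then have "c\<^sup>2 > 0"
    using c by simp
  \<comment> \<open>The hypothesis on \<open>c\<close> enters as
    \<open>1 + v \<bullet> v = p * c\<^sup>2\<close>, which turns the derivative of the weight into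
    a multiple of the weight itself without the factor \<open>p\<close>.\<close>
  have W': "p * (1 + v \<bullet> v) powr (- p - 1) = W / c\<^sup>2"
  proof -
    have "1 + v \<bullet> v = p * c\<^sup>2"
      using c by (simp add: vv algebra_simps)
    then show ?thesis
      using c \<open>c\<^sup>2 > 0\<close> by (simp add: W_def powr_diff)
  qed
  define J' where "J' y = c *\<^sub>R J y" for y
  have J': "v \<bullet> J' y = 0" "J' y \<bullet> v = 0" if "x \<bullet> y = 0" for y
    using that by (simp_all add: v_def J'_def J(2) inner_commute)
  have J'2: "J' y \<bullet> J' z = c\<^sup>2 * (y \<bullet> z)" for y z
    by (simp add: J'_def J(2) power2_eq_square)
  have J'_skew: "y \<bullet> J' z = - (z \<bullet> J' y)" for y z
    using skew[of y z] by (simp add: J'_def inner_commute)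
  have TJ': "T y = (y, J' y)" for y
    by (simp add: T_def J'_def)
  have Fu: "F u = (x, v)"
    by (simp add: F_def x_def v_def)
  have sff: "dderiv2 F u i j - dderiv F u (christoffel (pullback_metric round_metric \<phi>) u i j) =
      - (dderiv \<phi> u i \<bullet> dderiv \<phi> u j) *\<^sub>R (x, v)" for i j
    by (simp add: dF ddF dderiv_christoffel_sphere[OF dim lp \<open>u \<in> U\<close>] T_def x_def v_def
        linear_add[OF J(1)] linear_cmul[OF J(1)] algebra_simps)
  \<comment> \<open>All multiples of the inner product of the two frame vectors cancel: those with
    \<open>q\<close> between the second derivative and the two middle terms, the others between the
    second derivative and the derivative of the weight. The terms in \<open>z \<bullet> J' y\<close>
    cancel by skewness. What remains are products of one functional in each frame vector, as
    \<open>sphere_chart_trace\<close> sums.\<close>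
  have summand: "2 * sphere_cg p q (F u) (dderiv2 F u i j
        - dderiv F u (christoffel (pullback_metric round_metric \<phi>) u i j)) (C1, C2)
      + cg.DH p q (F u) (dderiv F u i) (dderiv F u j) (C1, C2)
      + cg.DH p q (F u) (dderiv F u j) (dderiv F u i) (C1, C2)
      - cg.DH p q (F u) (C1, C2) (dderiv F u i) (dderiv F u j) =
      W * ((dderiv \<phi> u i \<bullet> v) * (dderiv \<phi> u j \<bullet> (C2 + J' C1)) +
           (dderiv \<phi> u i \<bullet> (C2 + J' C1)) * (dderiv \<phi> u j \<bullet> v)
         - 2 / c\<^sup>2 * (v \<bullet> C2) * ((dderiv \<phi> u i \<bullet> v) * (dderiv \<phi> u j \<bullet> v)))" for i j
  proof -
    define a b where "a = dderiv \<phi> u i" and "b = dderiv \<phi> u j"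
    have xab: "x \<bullet> a = 0" "x \<bullet> b = 0"
      by (simp_all add: a_def b_def x_def id)
    have 1: "sphere_cg p q (F u) (- r *\<^sub>R (x, v)) (C1, C2) = - r * W * (1 + q * c\<^sup>2) * (v \<bullet> C2)" for r
      using C(1) by (simp add: sphere_cg_def Fu W_def[unfolded vv] xv vv inner_commute[of C2 v]
          x_def[symmetric] algebra_simps)
    have 2: "cg.DH p q (F u) (T y) (T z) (C1, C2) =
        W * (q * c\<^sup>2 * (y \<bullet> z) * (v \<bullet> C2) - (z \<bullet> J' y) * (C1 \<bullet> v) + (z \<bullet> v) * (y \<bullet> J' C1))"
      if "x \<bullet> y = 0" "x \<bullet> z = 0" for y z
      by (simp add: DH_sphere_cg Fu W_def[symmetric] TJ' J'[OF that(1)] J'[OF that(2)] J'2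
          J'_skew[of C1 y] inner_commute[of C2 v] inner_commute[of z y] algebra_simps)
    have 3: "cg.DH p q (F u) (C1, C2) (T y) (T z) =
        - 2 * (W / c\<^sup>2) * (v \<bullet> C2) * (c\<^sup>2 * (y \<bullet> z) - (y \<bullet> v) * (z \<bullet> v))
        - W * ((y \<bullet> C2) * (z \<bullet> v) + (y \<bullet> v) * (z \<bullet> C2))"
      if "x \<bullet> y = 0" "x \<bullet> z = 0" for y z
    proof -
      have "2 * p * (1 + v \<bullet> v) powr (- p - 1) = 2 * (W / c\<^sup>2)"
        using W' by simp
      then show ?thesis
        by (simp add: DH_sphere_cg Fu W_def[symmetric] TJ' J'[OF that(1)] J'[OF that(2)] J'2
          inner_commute[of C2 y] inner_commute[of C2 z] algebra_simps)
    qed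
    show ?thesis
      unfolding sff
      unfolding dF a_def[symmetric] b_def[symmetric] 1 2[OF xab] 2[OF xab(2,1)] 3[OF xab]
      using \<open>c\<^sup>2 > 0\<close> by (simp add: inner_add J'_skew[of b a] inner_commute[of b a] algebra_simps)
  qed
  have tr: "(\<Sum>i\<in>Basis. (dderiv \<phi> u i \<bullet> y) * (dderiv \<phi> u (dual i) \<bullet> z)) =
      y \<bullet> z - (x \<bullet> y) * (x \<bullet> z)" for y z
    unfolding dual_def x_def by (rule sphere_chart_trace[OF dim lp \<open>u \<in> U\<close>])
  have sum: "(\<Sum>i\<in>I. W * (X i + Y i - k * Z i)) = W * (sum X I + sum Y I - k * sum Z I)"
    for X Y Z :: "'e \<Rightarrow> real" and I k
    by (simp add: sum.distrib sum_subtractf flip: sum_distrib_left)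
  show ?thesis
    \<comment> \<open>Since \<open>x \<bullet> v = 0\<close>, the normal corrections vanish; with
      \<open>v \<bullet> J' C1 = 0\<close> and \<open>v \<bullet> v = c\<^sup>2\<close> the trace is
      \<open>W * (2 * (v \<bullet> C2) - 2 * (v \<bullet> C2))\<close>.\<close>
    unfolding summand sum tr
    using C(1) \<open>c\<^sup>2 > 0\<close> by (simp add: xv vv x_def[symmetric] inner_add J' inner_commute[of C2 v])
qed

lemma harmonic_hopf_section:
  fixes J :: "'a::euclidean_space \<Rightarrow> 'a"
  assumes dim: "DIM('a) = DIM('e::euclidean_space) + 1" and "q \<ge> 0"
    and J: "linear J" "\<And>y z. J y \<bullet> J z = y \<bullet> z" "\<And>y. y \<bullet> J y = 0"
    and c: "c\<^sup>2 * (p - 1) = 1" "p > 1"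
    and \<sigma>: "\<And>x. x \<in> sphere 0 1 \<Longrightarrow> \<sigma> x = (x, c *\<^sub>R J x)"
  shows "harmonic_map TYPE('e) TYPE('e \<times> 'e) (sphere 0 1) round_metric
    (tangent_bundle (sphere 0 1)) (cheeger_gromoll TYPE('e) (sphere 0 1) round_metric p q) \<sigma>"
  unfolding harmonic_map_def
proof (intro conjI allI impI ballI)
  show "riemannian_manifold TYPE('e) (sphere 0 1 :: 'a set) round_metric"
    using riemannian_manifold_ambientI[OF submanifold_sphere[OF dim] ambient_chart_round] .
  show "riemannian_manifold TYPE('e \<times> 'e) (tangent_bundle (sphere 0 1 :: 'a set))
      (cheeger_gromoll TYPE('e) (sphere 0 1) round_metric p q)"
    by (rule riemannian_manifold_ambientI[OF submanifold_tangent_bundle_sphere[OF dim]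
          ambient_chart_tangent_bundle_sphere[OF dim \<open>q \<ge> 0\<close>]])
  define T where "T = (\<lambda>y. (y, c *\<^sub>R J y))"
  have T: "bounded_linear T"
    unfolding T_def by (rule bounded_linear_graph[OF J(1)])
  have smooth: "smooth_on U (\<lambda>u. T (\<phi> u))" if "local_parametrization U \<phi> (sphere 0 1)"
    for U and \<phi> :: "'e \<Rightarrow> 'a"
    using local_parametrizationD[OF that] by (intro smooth_on_bounded_linear_compose[OF T])
  have \<sigma>T: "T (\<phi> u) = \<sigma> (\<phi> u)" if "local_parametrization U \<phi> (sphere 0 1)" "u \<in> U"
    for U u and \<phi> :: "'e \<Rightarrow> 'a"
    using local_parametrizationD(5)[OF that] by (simp add: \<sigma> T_def)
  have img: "\<sigma> ` sphere 0 1 \<subseteq> tangent_bundle (sphere 0 1)"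
    by (auto simp: tangent_bundle_sphere[OF dim] \<sigma> J(3))
  show "smooth_map TYPE('e) (sphere 0 1) (tangent_bundle (sphere 0 1)) \<sigma>"
    unfolding smooth_map_def
  proof (intro conjI allI impI img)
    fix U and \<phi> :: "'e \<Rightarrow> 'a"
    assume lp: "local_parametrization U \<phi> (sphere 0 1)"
    show "smooth_on U (\<sigma> \<circ> \<phi>)"
      by (rule smooth_on_cong[OF smooth[OF lp] local_parametrizationD(1)[OF lp]])
        (simp add: \<sigma>T[OF lp])
  qed
  fix U V u and \<phi> :: "'e \<Rightarrow> 'a" and \<psi> :: "'e \<times> 'e \<Rightarrow> 'a \<times> 'a"
  assume \<phi>: "local_parametrization U \<phi> (sphere 0 1)"
    and \<psi>: "local_parametrization V \<psi> (tangent_bundle (sphere 0 1))"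
    and u: "u \<in> U" "\<sigma> (\<phi> u) \<in> \<psi> ` V"
  note chart = local_parametrizationD[OF \<phi>] and chart' = local_parametrizationD[OF \<psi>]
  interpret ambient_chart "sphere_cg p q" V \<psi>
    "pullback_metric (cheeger_gromoll TYPE('e) (sphere 0 1) round_metric p q) \<psi>"
    by (rule ambient_chart_tangent_bundle_sphere[OF dim \<open>q \<ge> 0\<close> \<psi>])
  define F where "F = (\<lambda>u. T (\<phi> u))"
  \<comment> \<open>The local expression is a lift of \<open>F\<close> only where \<open>F\<close>
    lands in the image of \<open>\<psi>\<close>. This set is open because the image is relatively
    open in the tangent bundle and \<open>F\<close> is continuous.\<close>
  define S where "S = U \<inter> F -` (\<psi> ` V)"
  define f where "f = inv_into V \<psi> \<circ> \<sigma> \<circ> \<phi>"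
  have FU: "F ` U \<subseteq> tangent_bundle (sphere 0 1)"
    using img chart(5) \<sigma>T[OF \<phi>] by (auto simp: F_def)
  have cF: "continuous_on U F"
    unfolding F_def by (rule smooth_on_imp_continuous_on[OF smooth[OF \<phi>]])
  have "openin (top_of_set U) S"
    unfolding S_def using FU by (intro continuous_openin_preimage[OF cF _ chart'(3)]) blast
  then have "open S"
    using chart(1) openin_open_eq by blast
  have f: "f x = inv_into V \<psi> (F x)" if "x \<in> S" for x
    using that \<sigma>T[OF \<phi>] by (simp add: f_def F_def S_def)
  have fS: "f ` S \<subseteq> V" "\<And>x. x \<in> S \<Longrightarrow> \<psi> (f x) = F x"
    using f by (auto simp: S_def inv_into_into f_inv_into_f)
  have "continuous_on S (\<lambda>x. inv_into V \<psi> (F x))"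
    by (rule continuous_on_compose2[OF chart'(7) continuous_on_subset[OF cF]]) (auto simp: S_def)
  then have cf: "continuous_on S f"
    using f by (simp cong: continuous_on_cong)
  have "u \<in> S"
    using u \<sigma>T[OF \<phi> u(1)] by (simp add: S_def F_def)
  have sF: "smooth_on S F"
    unfolding F_def by (rule smooth_on_subset[OF smooth[OF \<phi>]]) (simp add: S_def)
  show "tension_field (pullback_metric round_metric \<phi>)
      (pullback_metric (cheeger_gromoll TYPE('e) (sphere 0 1) round_metric p q) \<psi>)
      (inv_into V \<psi> \<circ> \<sigma> \<circ> \<phi>) u = 0"
    unfolding f_def[symmetric]
  proof (rule tension_field_lift_eq_0[OF \<open>open S\<close> sF cf fS \<open>u \<in> S\<close>])
    fix w
    have fu: "f u \<in> V" "\<psi> (f u) = (\<phi> u, c *\<^sub>R J (\<phi> u))"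
      using fS \<open>u \<in> S\<close> by (auto simp: F_def T_def)
    \<comment> \<open>Vectors in the range of \<open>dderiv \<psi>\<close> are tangent to the
      bundle, as required of \<open>(C1, C2)\<close> in the trace computation.\<close>
    note id = tangent_bundle_sphere_chart_identities(3,4)[OF dim \<psi> fu(1), of w, unfolded fu(2) fst_conv snd_conv]
    show "(\<Sum>i\<in>Basis. let i' = THE v. \<forall>w. pullback_metric round_metric \<phi> u v w = i \<bullet> w in
        2 * sphere_cg p q (F u) (dderiv2 F u i i'
          - dderiv F u (christoffel (pullback_metric round_metric \<phi>) u i i')) (dderiv \<psi> (f u) w)
        + cg.DH p q (F u) (dderiv F u i) (dderiv F u i') (dderiv \<psi> (f u) w)
        + cg.DH p q (F u) (dderiv F u i') (dderiv F u i) (dderiv \<psi> (f u) w)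
        - cg.DH p q (F u) (dderiv \<psi> (f u) w) (dderiv F u i) (dderiv F u i')) = 0"
      using hopf_section_trace_eq_0[OF dim \<phi> u(1) J c id, of q]
      by (simp add: Let_def F_def T_def)
  qed
qed

theorem proposition5p4:
  fixes n :: nat and p q :: real
    and \<xi> :: "complex^'n::finite \<Rightarrow> complex^'n"
  assumes "n \<ge> 1"
    and "CARD('n) = n + 1"
    and "DIM('e::euclidean_space) = 2 * n + 1"
    and "p > 1"
    and "q \<ge> 0"
    and "hopf_vector_field \<xi>"
  shows "harmonic_map TYPE('e) TYPE('e \<times> 'e)
           (sphere 0 1) round_metric
           (tangent_bundle (sphere 0 1)) (cheeger_gromoll TYPE('e) (sphere 0 1) round_metric p q)
           (\<lambda>z. (z, (1 / sqrt (p - 1)) *\<^sub>R \<xi> z))"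
proof -
  obtain F :: "complex^'n \<Rightarrow> complex^'n" where F: "orthogonal_transformation F"
    and \<xi>: "\<And>z. z \<in> sphere 0 1 \<Longrightarrow> \<xi> (F z) = F (\<i> *s z)"
    using assms(6) unfolding hopf_vector_field_def by blast
  have F': "orthogonal_transformation (inv F)"
    by (rule orthogonal_transformation_inv[OF F])
  have FF: "F (inv F y) = y" for y
    using orthogonal_transformation_surj[OF F] by (simp add: surj_f_inv_f)
  have inner_i: "(\<i> *s y) \<bullet> (\<i> *s z) = y \<bullet> z" "y \<bullet> (\<i> *s y) = 0" for y z :: "complex^'n"
    by (simp_all add: inner_vec_def inner_complex_def algebra_simps)
  \<comment> \<open>\<open>\<xi>\<close> is prescribed only on the sphere. Conjugating
    multiplication by \<open>\<i>\<close> with \<open>F\<close> gives a linear map of the whole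
    space, isometric and skew, that agrees with \<open>\<xi>\<close> there.\<close>
  define J where "J y = F (\<i> *s inv F y)" for y
  show ?thesis
  proof (rule harmonic_hopf_section)
    show "DIM(complex^'n) = DIM('e) + 1"
      using assms(2,3) by simp
    have "linear (\<lambda>y :: complex^'n. \<i> *s y)"
      by (rule linearI) (simp_all add: vec_eq_iff algebra_simps)
    then show "linear J"
      using F F' unfolding J_def orthogonal_transformation_def
      by (metis (no_types, lifting) linear_compose comp_apply ext)
    show "J y \<bullet> J z = y \<bullet> z" for y z
      using F F' by (simp add: J_def orthogonal_transformation_def inner_i)
    show "y \<bullet> J y = 0" for y
    proof -
      have "y \<bullet> J y = F (inv F y) \<bullet> F (\<i> *s inv F y)"
        by (simp add: J_def FF)
      also have "\<dots> = 0"
        using F by (simp only: orthogonal_transformation_def inner_i)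
      finally show ?thesis .
    qed
    show "(1 / sqrt (p - 1))\<^sup>2 * (p - 1) = 1"
      using \<open>p > 1\<close> by (simp add: power_divide)
    fix x :: "complex^'n"
    assume "x \<in> sphere 0 1"
    then have "inv F x \<in> sphere 0 1"
      by (simp add: orthogonal_transformation_norm[OF F'])
    from \<xi>[OF this] show "(x, (1 / sqrt (p - 1)) *\<^sub>R \<xi> x) = (x, (1 / sqrt (p - 1)) *\<^sub>R J x)"
      by (simp add: J_def FF)
  qed fact+
qed

end
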